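(* $S_6<S_6^+$ is maximal at easiness-moment-level $(31,6)$. That is, at parameter $N=6$: for all $p_1,\dots,p_{31}\in\mathcal{CR}(6)$ and $\alpha_1,\dots,\alpha_{31}\in\mathbb{C}$ such that $\xi=\sum_{i=1}^{31}\alpha_i\xi_{p_i}\in(\mathbb{C}^6)^{\otimes 6}$ is non-zero, $\langle\mathcal{NC},\xi\rangle$ equals $\mathcal{P}$ or $\mathcal{NC}$.
   Context: Fix $N$ and write $[k]=\{1,\dots,k\}$. $\mathcal{P}(k)$ is the set of set partitions of $[k]$; $x\sim_p y$ means $x,y$ lie in the same block of $p$. A crossing of $p\in\mathcal{P}(k)$ is a four-element subset $\{\kappa_1<\kappa_2<\kappa_3<\kappa_4\}\subseteq[k]$ with $\kappa_1\sim_p\kappa_3$, $\kappa_2\sim_p\kappa_4$, $\kappa_1\not\sim_p\kappa_2$; $\mathcal{CR}(k)$ is the set of $p\in\mathcal{P}(k)$ having at least one crossing. For $p\in\mathcal{P}(k)$, $\xi_p\in(\mathbb{C}^N)^{\otimes k}$ is $\xi_p=\sum e_{i_1}\otimes\cdots\otimes e_{i_k}$, the sum over all $(i_1,\dots,i_k)\in[N]^k$ with $i_x=i_y$ whenever $x\sim_p y$. More generally $\mathcal{P}(k,\ell)$ is the set of partitions of a set of $k$ upper and $\ell$ lower points; for $p\in\mathcal{P}(k,\ell)$ the matrix $T_p\in M_{N^\ell\times N^k}(\mathbb{C})$ has $((i_1,\dots,i_\ell),(j_1,\dots,j_k))$-entry $1$ if, writing $j_1,\dots,j_k$ on the upper points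 and $i_1,\dots,i_\ell$ on the lower points (left to right), points in the same block carry equal indices, and $0$ otherwise. So $\xi_p=T_p$ for $p\in\mathcal{P}(0,k)=\mathcal{P}(k)$. Crossings in $\mathcal{P}(k,\ell)$ are detected by ordering the points as upper points left-to-right followed by lower points right-to-left. A Tannaka--Krein dual (at parameter $N$) is a family $\mathcal{C}$ of linear subspaces $\hom_{\mathcal{C}}(k,\ell)\subseteq M_{N^\ell\times N^k}(\mathbb{C})$, $k,\ell\geq 0$, closed under tensor (Kronecker) products, composition of composable maps, and adjoints, containing $\mathrm{id}_N\in\hom_{\mathcal C}(1,1)$ and the row vector in $\hom_{\mathcal C}(2,0)$ with $(i,j)$-entry $\delta_{i,j}$. $\mathcal{P}$ (the dual of the classical permutation group $S_N$) is given by $\hom_{\mathcal{P}}(k,\ell)=\operatorname{span}\{T_p: p\in\mathcal{P}(k,\ell)\}$, and $\mathcal{NC}$ (the dual of the quantum permutation group $S_N^+$) by $\hom_{\mathcal{NC}}(k,\ell)=\operatorname{span}\{T_p: p\in\mathcal{P}(k,\ell)\text{ non-crossing}\}$. For $\xi\in(\mathbb{C}^N)^{\otimes k}=M_{N^k\times 1}(\mathbb{C})$, $\langle\mathcal{NC},\xi\rangle$ is the smallest Tannaka--Krein dual containing $\mathcal{NC}$ with $\xi\in\hom(0,k)$. $S_N\leq S_N^+$ is maximal at easiness-moment-level $(m,k)$ if for all non-zero $\xi=\sum_{i=1}^m\alpha_i\xi_{p_i}$ with $p_i\in\mathcal{CR}(k)$, $\langle\mathcal{NC},\xi\rangle$ equals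 $\mathcal{P}$ or $\mathcal{NC}$. *)

theory Defs
  imports
    "HOL-Library.Disjoint_Sets"
    "HOL-Library.FuncSet"
    "Jordan_Normal_Form.VS_Connect"
    "Jordan_Normal_Form.Schur_Decomposition"
begin

section \<open>Set partitions and crossings\<close>

definition same_block :: "'a set set \<Rightarrow> 'a \<Rightarrow> 'a \<Rightarrow> bool" where
  "same_block p x y \<longleftrightarrow> (\<exists>B\<in>p. x \<in> B \<and> y \<in> B)"

text \<open>The points are compared through their positions \<open>pos\<close> in a linear ordering.\<close>

definition has_crossing :: "('a \<Rightarrow> nat) \<Rightarrow> 'a set set \<Rightarrow> bool" where
  "has_crossing pos p \<longleftrightarrow>
    (\<exists>x1 x2 x3 x4. pos x1 < pos x2 \<and> pos x2 < pos x3 \<and> pos x3 < pos x4 \<and>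
       same_block p x1 x3 \<and> same_block p x2 x4 \<and> \<not> same_block p x1 x2)"

definition partitions :: "nat \<Rightarrow> nat set set set" where
  "partitions k = {p. partition_on {1..k} p}"

definition crossing_partitions :: "nat \<Rightarrow> nat set set set" where
  "crossing_partitions k = {p \<in> partitions k. has_crossing (\<lambda>x. x) p}"

text \<open>In the two-row case \<open>Inl x\<close> is the \<open>x\<close>-th upper and \<open>Inr y\<close> the \<open>y\<close>-th lower
  point, both counted from the left. The position function lists the upper points from left to
  right and then the lower points from right to left.\<close>

definition two_row_partitions :: "nat \<Rightarrow> nat \<Rightarrow> (nat + nat) set set set" where
  "two_row_partitions k l = {p. partition_on ({1..k} <+> {1..l}) p}"

definition circular_pos :: "nat \<Rightarrow> nat \<Rightarrow> nat + nat \<Rightarrow> nat" where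
  "circular_pos k l = case_sum (\<lambda>x. x) (\<lambda>y. k + (l + 1 - y))"

definition noncrossing_two_row_partitions :: "nat \<Rightarrow> nat \<Rightarrow> (nat + nat) set set set" where
  "noncrossing_two_row_partitions k l =
     {p \<in> two_row_partitions k l. \<not> has_crossing (circular_pos k l) p}"


section \<open>Tensors\<close>

definition kronecker :: "complex mat \<Rightarrow> complex mat \<Rightarrow> complex mat" where
  "kronecker A B = mat (dim_row A * dim_row B) (dim_col A * dim_col B)
     (\<lambda>(r, c). A $$ (r div dim_row B, c div dim_col B) * B $$ (r mod dim_row B, c mod dim_col B))"

text \<open>A multi-index \<open>(i\<^sub>1, \<dots>, i\<^sub>n)\<close> with entries in \<open>{0..<N}\<close> is identified with the number
  below \<open>N ^ n\<close> having these base \<open>N\<close> digits, \<open>i\<^sub>1\<close> being the most significant one. This is the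
  convention matching \<open>kronecker\<close>. The entry \<open>i\<^sub>x\<close> is recovered as \<open>digit N n r x\<close>,
  for \<open>x \<in> {1..n}\<close>.\<close>

definition digit :: "nat \<Rightarrow> nat \<Rightarrow> nat \<Rightarrow> nat \<Rightarrow> nat" where
  "digit N n r x = r div N ^ (n - x) mod N"

definition T_mat :: "nat \<Rightarrow> nat \<Rightarrow> nat \<Rightarrow> (nat + nat) set set \<Rightarrow> complex mat" where
  "T_mat N k l p = mat (N ^ l) (N ^ k) (\<lambda>(r, c).
     let idx = case_sum (digit N k c) (digit N l r)
     in if \<forall>x y. same_block p x y \<longrightarrow> idx x = idx y then 1 else 0)"

abbreviation mat_space :: "nat \<Rightarrow> nat \<Rightarrow> (complex, complex mat) module" where
  "mat_space nr nc \<equiv> module_mat TYPE(complex) nr nc"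

text \<open>The space of \<open>k\<close>-tensors is \<open>mat_space (N ^ k) 1\<close>; the standard basis vectors of
  \<open>\<complex>\<^sup>N\<close> are indexed by \<open>{0..<N}\<close>.\<close>

definition basis_col :: "nat \<Rightarrow> nat \<Rightarrow> complex mat" where
  "basis_col N i = mat_of_cols N [unit_vec N i]"

definition basis_tensor :: "nat \<Rightarrow> nat \<Rightarrow> (nat \<Rightarrow> nat) \<Rightarrow> complex mat" where
  "basis_tensor N k i = foldr kronecker (map (\<lambda>x. basis_col N (i x)) [1..<k + 1]) (1\<^sub>m 1)"

definition xi :: "nat \<Rightarrow> nat \<Rightarrow> nat set set \<Rightarrow> complex mat" where
  "xi N k p = finsum (mat_space (N ^ k) 1) (basis_tensor N k)
     {i \<in> {1..k} \<rightarrow>\<^sub>E {0..<N}. \<forall>x y. same_block p x y \<longrightarrow> i x = i y}"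

lemma kronecker_carrier:
  "A \<in> carrier_mat a b \<Longrightarrow> B \<in> carrier_mat c d \<Longrightarrow> kronecker A B \<in> carrier_mat (a * c) (b * d)"
  by (auto simp: kronecker_def)

lemma basis_tensor_list_entry:
  assumes "\<forall>i\<in>set is. i < N"
  shows "foldr kronecker (map (basis_col N) is) (1\<^sub>m 1) \<in> carrier_mat (N ^ length is) 1 \<and>
    (\<forall>r < N ^ length is. foldr kronecker (map (basis_col N) is) (1\<^sub>m 1) $$ (r, 0) =
       (if \<forall>j < length is. is ! j = r div N ^ (length is - Suc j) mod N then 1 else 0))"
  using assms
proof (induction "is")
  case Nil
  then show ?case by simp
next
  case (Cons a s)
  let ?F = "foldr kronecker (map (basis_col N) s) (1\<^sub>m 1)"
  let ?n = "length s"
  have F: "?F \<in> carrier_mat (N ^ ?n) 1"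
    and Fe: "r < N ^ ?n \<Longrightarrow> ?F $$ (r, 0) =
       (if \<forall>j < ?n. s ! j = r div N ^ (?n - Suc j) mod N then 1 else 0)" for r
    using Cons.IH Cons.prems by (simp_all del: One_nat_def)
  have a: "a < N" using Cons.prems by simp
  have B: "basis_col N a \<in> carrier_mat N 1" by (simp add: basis_col_def mat_of_cols_def)
  have Be: "r < N \<Longrightarrow> basis_col N a $$ (r, 0) = (if r = a then 1 else 0)" for r
    using a by (simp add: basis_col_def mat_of_cols_def)
  have *: "kronecker (basis_col N a) ?F $$ (r, 0) =
      (if \<forall>j < Suc ?n. (a # s) ! j = r div N ^ (Suc ?n - Suc j) mod N then 1 else 0)"
    if r: "r < N ^ Suc ?n" for r
  proof -
    have p: "0 < N ^ ?n" using a by simp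
    have rd: "r div N ^ ?n < N" using r by (simp add: less_mult_imp_div_less mult.commute)
    have "r mod N ^ ?n div N ^ (?n - Suc j) mod N = r div N ^ (?n - Suc j) mod N"
      if "j < ?n" for j
    proof -
      have "N ^ ?n = N ^ (?n - Suc j) * (N * N ^ j)"
      proof -
        have "?n = ?n - Suc j + Suc j" using that by simp
        then show ?thesis by (metis power_Suc power_add)
      qed
      then have "r mod N ^ ?n div N ^ (?n - Suc j) = (r div N ^ (?n - Suc j)) mod (N * N ^ j)"
        using a by (simp add: mod_mult2_eq)
      then show ?thesis by (simp add: mod_mod_cancel)
    qed
    then have "(\<forall>j < Suc ?n. (a # s) ! j = r div N ^ (Suc ?n - Suc j) mod N) \<longleftrightarrow>
       r div N ^ ?n = a \<and> (\<forall>j < ?n. s ! j = r mod N ^ ?n div N ^ (?n - Suc j) mod N)"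
      using rd by (auto simp: All_less_Suc2)
    then show ?thesis
      using B F r rd Fe[of "r mod N ^ ?n"] p by (simp add: kronecker_def Be del: One_nat_def)
  qed
  show ?case
    using kronecker_carrier[OF B F] * by simp
qed

lemma basis_tensor_carrier:
  assumes "i \<in> {1..k} \<rightarrow> {0..<N}"
  shows "basis_tensor N k i \<in> carrier_mat (N ^ k) 1"
proof -
  have "\<forall>x\<in>set (map i [1..<k + 1]). x < N" using assms by auto
  from basis_tensor_list_entry[OF this] show ?thesis
    by (simp add: basis_tensor_def comp_def del: upt_Suc)
qed

lemma basis_tensor_entry:
  assumes "i \<in> {1..k} \<rightarrow> {0..<N}" "r < N ^ k"
  shows "basis_tensor N k i $$ (r, 0) =
    (if \<forall>x\<in>{1..k}. i x = digit N k r x then 1 else 0)"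
proof -
  have "(\<forall>x\<in>{1..k}. P x) \<longleftrightarrow> (\<forall>j<k. P (Suc j))" for P
    by (metis Suc_le_eq Suc_pred' atLeastAtMost_iff le_simps(3) less_Suc_eq_0_disj One_nat_def zero_less_Suc)
  note * = this[of "\<lambda>x. i x = digit N k r x"]
  have "\<forall>x\<in>set (map i [1..<k + 1]). x < N" using assms by auto
  from basis_tensor_list_entry[OF this] show ?thesis
    unfolding * using assms(2)
    by (simp add: basis_tensor_def comp_def digit_def del: upt_Suc)
qed

lemma finsum_mat_space:
  assumes "finite S" "\<And>s. s \<in> S \<Longrightarrow> f s \<in> carrier_mat nr nc"
  shows "finsum (mat_space nr nc) f S = mat nr nc (\<lambda>ij. \<Sum>s\<in>S. f s $$ ij)"
proof -
  interpret abelian_group "mat_space nr nc" by (rule abelian_group_mat)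
  show ?thesis using assms
  proof (induction S)
    case empty
    then show ?case by (auto simp: module_mat_simps)
  next
    case (insert x F)
    then have "finsum (mat_space nr nc) f (insert x F) = f x + finsum (mat_space nr nc) f F"
      by (subst finsum_insert) (auto simp: module_mat_simps)
    then show ?case using insert by (auto simp: module_mat_simps)
  qed
qed

lemma xi_eq_T_mat:
  assumes "p \<in> partitions k"
  shows "xi N k p = T_mat N 0 k ((`) Inr ` p)"
proof -
  let ?S = "{i \<in> {1..k} \<rightarrow>\<^sub>E {0..<N}. \<forall>x y. same_block p x y \<longrightarrow> i x = i y}"
  have fin: "finite ?S" by (simp add: finite_PiE)
  have xi: "xi N k p = mat (N ^ k) 1 (\<lambda>ij. \<Sum>s\<in>?S. basis_tensor N k s $$ ij)"
    unfolding xi_def using fin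
    by (intro finsum_mat_space) (auto intro!: basis_tensor_carrier simp: PiE_iff simp del: One_nat_def)
  have range: "x \<in> {1..k}" "y \<in> {1..k}" if "same_block p x y" for x y
    using assms that by (auto simp: partitions_def same_block_def partition_on_def)
  have blocks: "(\<forall>u v. same_block ((`) Inr ` p) u v \<longrightarrow> f u = f v) \<longleftrightarrow>
      (\<forall>x y. same_block p x y \<longrightarrow> f (Inr x) = f (Inr y))" for f :: "nat + nat \<Rightarrow> nat"
    unfolding same_block_def by blast
  have "(\<Sum>s\<in>?S. basis_tensor N k s $$ (r, 0)) =
      (if \<forall>x y. same_block p x y \<longrightarrow> digit N k r x = digit N k r y then 1 else 0)"
    if r: "r < N ^ k" for r
  proof -
    let ?d = "restrict (digit N k r) {1..k}"
    have N: "N > 0 \<or> k = 0" using r by (cases "N = 0") (auto simp: power_0_left split: if_splits)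
    have "(\<Sum>s\<in>?S. basis_tensor N k s $$ (r, 0)) = (\<Sum>s\<in>?S. if s = ?d then 1 else 0)"
    proof (rule sum.cong[OF refl])
      fix s assume s: "s \<in> ?S"
      then have "(\<forall>x\<in>{1..k}. s x = digit N k r x) \<longleftrightarrow> s = ?d"
        by (auto simp: fun_eq_iff PiE_iff extensional_def)
      with s r show "basis_tensor N k s $$ (r, 0) = (if s = ?d then 1 else 0)"
        by (subst basis_tensor_entry) auto
    qed
    also have "\<dots> = (if ?d \<in> ?S then 1 else 0)" using fin by simp
    also have "?d \<in> ?S \<longleftrightarrow> (\<forall>x y. same_block p x y \<longrightarrow> digit N k r x = digit N k r y)"
      using N range by (auto simp: digit_def)
    finally show ?thesis .
  qed
  then show ?thesis
    unfolding xi T_mat_def by (intro eq_matI) (auto simp: blocks Let_def)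
qed



section \<open>Tannaka--Krein duals\<close>

type_synonym hom_family = "nat \<Rightarrow> nat \<Rightarrow> complex mat set"

definition tannaka_krein_dual :: "nat \<Rightarrow> hom_family \<Rightarrow> bool" where
  "tannaka_krein_dual N C \<longleftrightarrow>
     (\<forall>k l. VectorSpace.subspace class_ring (C k l) (mat_space (N ^ l) (N ^ k))) \<and>
     (\<forall>k l k' l'. \<forall>A\<in>C k l. \<forall>B\<in>C k' l'. kronecker A B \<in> C (k + k') (l + l')) \<and>
     (\<forall>k l m. \<forall>A\<in>C l m. \<forall>B\<in>C k l. A * B \<in> C k m) \<and>
     (\<forall>k l. \<forall>A\<in>C k l. mat_adjoint A \<in> C l k) \<and>
     1\<^sub>m N \<in> C 1 1 \<and>
     mat 1 (N ^ 2) (\<lambda>(_, c). if digit N 2 c 1 = digit N 2 c 2 then 1 else 0) \<in> C 2 0"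

definition P_dual :: "nat \<Rightarrow> hom_family" where
  "P_dual N k l = LinearCombinations.module.span class_ring (mat_space (N ^ l) (N ^ k))
     (T_mat N k l ` two_row_partitions k l)"

definition NC_dual :: "nat \<Rightarrow> hom_family" where
  "NC_dual N k l = LinearCombinations.module.span class_ring (mat_space (N ^ l) (N ^ k))
     (T_mat N k l ` noncrossing_two_row_partitions k l)"

text \<open>The smallest dual containing \<open>NC_dual N\<close> and having the \<open>k\<close>-tensor \<open>v\<close> in \<open>hom(0,k)\<close>;
  families are compared by inclusion of all their hom-spaces.\<close>

definition NC_generated :: "nat \<Rightarrow> nat \<Rightarrow> complex mat \<Rightarrow> hom_family" where
  "NC_generated N k v = Inf {C. tannaka_krein_dual N C \<and> NC_dual N \<le> C \<and> v \<in> C 0 k}"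

lemma NC_generated_le:
  "tannaka_krein_dual N C \<Longrightarrow> NC_dual N \<le> C \<Longrightarrow> v \<in> C 0 k \<Longrightarrow> NC_generated N k v \<le> C"
  unfolding NC_generated_def by (auto intro: Inf_lower)

lemma subspace_mat_iff:
  "VectorSpace.subspace class_ring W (mat_space nr nc) \<longleftrightarrow>
     W \<subseteq> carrier_mat nr nc \<and> 0\<^sub>m nr nc \<in> W \<and> (\<forall>A\<in>W. \<forall>B\<in>W. A + B \<in> W) \<and>
     (\<forall>c. \<forall>A\<in>W. c \<cdot>\<^sub>m A \<in> W)"
proof -
  have v: "vectorspace class_ring (mat_space nr nc)" by (rule matrix_vs)
  then have m: "Module.module class_ring (mat_space nr nc)" by (simp add: vectorspace_def)
  show ?thesis
    using v m by (auto simp: VectorSpace.subspace_def LinearCombinations.submodule_def matrix_vs_simps)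
qed

lemma tannaka_krein_dual_all_matrices:
  "tannaka_krein_dual N (\<lambda>k l. carrier_mat (N ^ l) (N ^ k))"
  unfolding tannaka_krein_dual_def subspace_mat_iff
  by (auto simp: kronecker_def mat_adjoint_def power_add)

lemma NC_dual_le_all_matrices: "NC_dual N \<le> (\<lambda>k l. carrier_mat (N ^ l) (N ^ k))"
proof (intro le_funI)
  fix k l
  interpret vectorspace class_ring "mat_space (N ^ l) (N ^ k)" by (rule matrix_vs)
  have "T_mat N k l ` noncrossing_two_row_partitions k l \<subseteq> carrier (mat_space (N ^ l) (N ^ k))"
    by (auto simp: T_mat_def matrix_vs_simps)
  from span_is_subset2[OF this] show "NC_dual N k l \<subseteq> carrier_mat (N ^ l) (N ^ k)"
    by (simp add: NC_dual_def matrix_vs_simps)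
qed

lemma tannaka_krein_dual_NC_generated:
  assumes v: "v \<in> carrier_mat (N ^ k) 1"
  shows "tannaka_krein_dual N (NC_generated N k v)"
    and "NC_dual N \<le> NC_generated N k v"
    and "v \<in> NC_generated N k v 0 k"
proof -
  define F where "F = {C. tannaka_krein_dual N C \<and> NC_dual N \<le> C \<and> v \<in> C 0 k}"
  have all: "(\<lambda>k l. carrier_mat (N ^ l) (N ^ k)) \<in> F"
    using v by (simp add: F_def tannaka_krein_dual_all_matrices NC_dual_le_all_matrices)
  have G: "NC_generated N k v a b = (\<Inter>C\<in>F. C a b)" for a b
    by (simp add: NC_generated_def F_def Inf_fun_def image_image)
  show "NC_dual N \<le> NC_generated N k v"
    unfolding NC_generated_def by (rule Inf_greatest) auto
  show "v \<in> NC_generated N k v 0 k"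
    unfolding G by (auto simp: F_def)
  have "(\<Inter>C\<in>F. C a b) \<subseteq> carrier_mat (N ^ b) (N ^ a)" for a b
    using all by blast
  moreover have
    "0\<^sub>m (N ^ l) (N ^ k) \<in> C k l"
    "A \<in> C k l \<Longrightarrow> B \<in> C k l \<Longrightarrow> A + B \<in> C k l"
    "A \<in> C k l \<Longrightarrow> c \<cdot>\<^sub>m A \<in> C k l"
    "A \<in> C k l \<Longrightarrow> B \<in> C k' l' \<Longrightarrow> kronecker A B \<in> C (k + k') (l + l')"
    "A \<in> C k l \<Longrightarrow> mat_adjoint A \<in> C l k"
    "1\<^sub>m N \<in> C 1 1"
    "mat 1 (N ^ 2) (\<lambda>(_, c). if digit N 2 c 1 = digit N 2 c 2 then 1 else 0) \<in> C 2 0"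
    if "C \<in> F" for C k l k' l' m A B c
    using that by (simp_all add: F_def tannaka_krein_dual_def subspace_mat_iff del: One_nat_def)
  moreover have comp: "A * B \<in> C k m"
    if "A \<in> (\<Inter>C\<in>F. C l m)" "B \<in> (\<Inter>C\<in>F. C k l)" "C \<in> F" for A B C k l m
  proof -
    have "A \<in> C l m" "B \<in> C k l" "tannaka_krein_dual N C"
      using that by (auto simp: F_def)
    then show ?thesis unfolding tannaka_krein_dual_def by metis
  qed
  ultimately show "tannaka_krein_dual N (NC_generated N k v)"
    unfolding tannaka_krein_dual_def subspace_mat_iff G
  proof (intro conjI allI ballI INT_I, goal_cases)
    case (6 k l m A B C)
    show ?case by (rule comp[OF 6(10-12)])
  qed (simp_all add: INT_iff del: One_nat_def)
qed

definition maximal_at_easiness_moment_level :: "nat \<Rightarrow> nat \<Rightarrow> nat \<Rightarrow> bool" where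
  "maximal_at_easiness_moment_level N m k \<longleftrightarrow>
     (\<forall>(p :: nat \<Rightarrow> nat set set) (\<alpha> :: nat \<Rightarrow> complex) v.
        (\<forall>i\<in>{1..m}. p i \<in> crossing_partitions k) \<longrightarrow>
        v = finsum (mat_space (N ^ k) 1) (\<lambda>i. \<alpha> i \<cdot>\<^sub>m xi N k (p i)) {1..m} \<longrightarrow>
        v \<noteq> 0\<^sub>m (N ^ k) 1 \<longrightarrow>
        NC_generated N k v = P_dual N \<or> NC_generated N k v = NC_dual N)"

end

theory Submission
  imports Defs
begin

text \<open>Let \<open>C\<close> be a dual above \<open>NC\<close> that contains the tensor \<open>\<xi> = \<Sum> a\<^sub>r \<xi>\<^sub>r\<close>, where \<open>r\<close> runs through the 71
  crossing partitions of six points. If \<open>C\<close> contains the crossing of four points, then it contains the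
  swap and hence all partition maps, so that \<open>C = P\<close>. Otherwise consider the tensors obtained from
  \<open>\<xi>\<close> by rotating, deleting points (summing over their index) and merging neighbours. On four points
  the coefficient of the only crossing partition must vanish. On five points there are ten crossing
  partitions; their coefficients satisfy ten equations from contractions to four points, which have
  only the zero solution, so they vanish as well. The contractions from six to five points therefore
  yield 120 linear equations for the 71 coefficients \<open>a\<^sub>r\<close>. Their solution space has dimension five,
  and each nonzero solution has at least 32 nonzero entries. Since the equations are real, this
  applies to the real and imaginary parts of \<open>a\<close>, so that 31 summands force \<open>\<xi> = 0\<close>.

  That the partition maps form a dual follows from their description as the matrices invariant under
  simultaneous permutations of the indices.\<close>

section \<open>Matrices as functions of multi-indices\<close>

text \<open>The contraction equations do not suffice by themselves, because they have nonzero
  solutions. What remains is to bound from below the minimum weight of a linear code of length 71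
  and dimension five. Dually, the 71 coefficients are linear forms on the solution space, that is
  (apart from zero forms) points of a projective space of dimension four, and a nonzero solution
  with at most 31 nonzero entries is a hyperplane containing at least 40 of them. Instead of listing
  all hyperplanes spanned by these points, the proof follows a short tree of case distinctions on
  which forms vanish and closes its leaves by a counting bound. The parameter 6 of the tensor space
  enters the equations as the weight of a deleted singleton. Six coefficients serve as parameters,
  tied by one relation; with them each equation used has a single unknown and an integral solution.
  Elimination is fraction-free, so that the whole computation stays in the integers.\<close>

definition words :: "nat \<Rightarrow> nat \<Rightarrow> nat list set" where
  "words N k = {xs. length xs = k \<and> set xs \<subseteq> {..<N}}"

definition digits :: "nat \<Rightarrow> nat \<Rightarrow> nat \<Rightarrow> nat list" where
  "digits N k r = map (digit N k r) [1..<Suc k]"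

text \<open>In this form Kronecker products split words and matrix products are sums over words, so
  the digit arithmetic is settled once. Only the values of \<open>G\<close> on words matter.\<close>

definition tmat :: "nat \<Rightarrow> nat \<Rightarrow> nat \<Rightarrow> (nat list \<Rightarrow> nat list \<Rightarrow> complex) \<Rightarrow> complex mat" where
  "tmat N k l G = mat (N ^ l) (N ^ k) (\<lambda>(r, c). G (digits N l r) (digits N k c))"

lemma length_digits [simp]: "length (digits N k r) = k"
  by (simp add: digits_def)

lemma nth_digits: "i < k \<Longrightarrow> digits N k r ! i = r div N ^ (k - Suc i) mod N"
  by (simp add: digits_def digit_def nth_append del: upt_Suc)

lemma finite_words [simp]: "finite (words N k)"
  using finite_lists_length_eq[of "{..<N}" k] by (simp add: words_def conj_commute)

lemma length_words: "xs \<in> words N k \<Longrightarrow> length xs = k"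
  by (simp add: words_def)

lemma words_0 [simp]: "words N 0 = {[]}"
  by (auto simp: words_def)

lemma words_append_iff:
  "length xs = k \<Longrightarrow> xs @ ys \<in> words N (k + l) \<longleftrightarrow> xs \<in> words N k \<and> ys \<in> words N l"
  by (auto simp: words_def)

lemma words_Suc: "words N (Suc k) = (\<lambda>(x, xs). x # xs) ` ({..<N} \<times> words N k)"
  by (auto simp: words_def length_Suc_conv image_iff)

lemma sum_words_Suc: "(\<Sum>xs\<in>words N (Suc k). f xs) = (\<Sum>x<N. \<Sum>xs\<in>words N k. f (x # xs))"
  unfolding words_Suc by (subst sum.reindex) (auto simp: inj_on_def sum.cartesian_product split_def)

lemma digits_mem: "r < N ^ k \<Longrightarrow> digits N k r \<in> words N k"
proof -
  assume r: "r < N ^ k"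
  then have "k = 0 \<or> 0 < N" by (cases "N = 0") (auto simp: power_0_left split: if_splits)
  then show ?thesis
    by (auto simp: words_def digits_def digit_def)
qed

lemma digits_append:
  assumes "r < N ^ (k + l)"
  shows "digits N (k + l) r = digits N k (r div N ^ l) @ digits N l (r mod N ^ l)"
proof (rule nth_equalityI)
  fix i assume i: "i < length (digits N (k + l) r)"
  show "digits N (k + l) r ! i = (digits N k (r div N ^ l) @ digits N l (r mod N ^ l)) ! i"
  proof (cases "i < k")
    case True
    then have "N ^ (k + l - Suc i) = N ^ l * N ^ (k - Suc i)"
      by (simp add: add.commute flip: power_add)
    then show ?thesis using True i
      by (simp add: nth_append nth_digits power_add div_mult2_eq del: add_diff_assoc2 diff_add_assoc2)
  next
    case False
    define j where "j = i - k"
    have j: "j < l" "i = k + j" using False i by (auto simp: j_def)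
    \<comment> \<open>After division by \<open>N ^ (l - Suc j)\<close>, reduction modulo
      \<open>N ^ l\<close> becomes reduction modulo \<open>N * N ^ j\<close>, which the final
      reduction modulo \<open>N\<close> absorbs.\<close>
    have "N ^ l = N ^ (l - Suc j) * (N * N ^ j)"
    proof -
      have "l = l - Suc j + Suc j" using j by simp
      then show ?thesis by (metis power_Suc power_add)
    qed
    then have "r mod N ^ l div N ^ (l - Suc j) = (r div N ^ (l - Suc j)) mod (N * N ^ j)"
      using assms j by (cases "N = 0") (auto simp: mod_mult2_eq power_0_left)
    then have "r mod N ^ l div N ^ (l - Suc j) mod N = r div N ^ (l - Suc j) mod N"
      by (simp add: mod_mod_cancel)
    then show ?thesis using j i
      by (simp add: nth_append nth_digits)
  qed
qed simp

lemma inj_on_digits: "inj_on (digits N k) {..<N ^ k}"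
proof (induction k)
  case 0
  show ?case by (simp add: inj_on_def)
next
  case (Suc k)
  show ?case
  proof (rule inj_onI)
    fix r s assume rs: "r \<in> {..<N ^ Suc k}" "s \<in> {..<N ^ Suc k}" "digits N (Suc k) r = digits N (Suc k) s"
    then have "digits N k (r div N) @ digits N 1 (r mod N) = digits N k (s div N) @ digits N 1 (s mod N)"
      using digits_append[of r N k 1] digits_append[of s N k 1] by simp
    then have "digits N k (r div N) = digits N k (s div N)" "digits N 1 (r mod N) = digits N 1 (s mod N)"
      by simp_all
    moreover have "digits N 1 t = [t mod N]" for t by (simp add: digits_def digit_def)
    ultimately have "r div N = s div N" "r mod N = s mod N"
      using Suc rs by (auto simp: less_mult_imp_div_less mult.commute dest!: inj_onD)
    then show "r = s" by (metis div_mult_mod_eq)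
  qed
qed

lemma card_words: "card (words N k) = N ^ k"
  using card_lists_length_eq[of "{..<N}" k] by (simp add: words_def conj_commute)

text \<open>Surjectivity follows by counting: both sets have \<open>N ^ k\<close> elements.\<close>

lemma bij_betw_digits: "bij_betw (digits N k) {..<N ^ k} (words N k)"
  unfolding bij_betw_def
proof
  have "digits N k ` {..<N ^ k} \<subseteq> words N k" by (auto simp: digits_mem)
  moreover have "card (digits N k ` {..<N ^ k}) = card (words N k)"
    by (simp add: card_image inj_on_digits card_words)
  ultimately show "digits N k ` {..<N ^ k} = words N k" by (simp add: card_subset_eq)
qed (rule inj_on_digits)

lemma tmat_carrier [simp]: "tmat N k l G \<in> carrier_mat (N ^ l) (N ^ k)"
  by (simp add: tmat_def)

lemma tmat_dim [simp]: "dim_row (tmat N k l G) = N ^ l" "dim_col (tmat N k l G) = N ^ k"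
  by (simp_all add: tmat_def)

lemma tmat_eq_iff:
  "tmat N k l G = tmat N k l H \<longleftrightarrow> (\<forall>xs\<in>words N l. \<forall>ys\<in>words N k. G xs ys = H xs ys)"
  (is "?L \<longleftrightarrow> ?R")
proof
  assume eq: ?L
  show ?R
  proof (intro ballI)
    fix xs ys assume "xs \<in> words N l" "ys \<in> words N k"
    then obtain r c where "r < N ^ l" "c < N ^ k" "xs = digits N l r" "ys = digits N k c"
      using bij_betw_imp_surj_on[OF bij_betw_digits] by (metis imageE lessThan_iff)
    then show "G xs ys = H xs ys"
      using arg_cong[OF eq, of "\<lambda>A. A $$ (r, c)"] by (simp add: tmat_def)
  qed
qed (auto simp: tmat_def digits_mem intro!: eq_matI)

lemmas tmat_cong = tmat_eq_iff[THEN iffD2, rule_format]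

lemma tmat_zero: "0\<^sub>m (N ^ l) (N ^ k) = tmat N k l (\<lambda>_ _. 0)"
  by (auto simp: tmat_def)

lemma tmat_add: "tmat N k l G + tmat N k l H = tmat N k l (\<lambda>xs ys. G xs ys + H xs ys)"
  by (auto simp: tmat_def)

lemma tmat_smult: "c \<cdot>\<^sub>m tmat N k l G = tmat N k l (\<lambda>xs ys. c * G xs ys)"
  by (auto simp: tmat_def)

lemma tmat_one: "1\<^sub>m (N ^ k) = tmat N k k (\<lambda>xs ys. of_bool (xs = ys))"
  by (auto simp: tmat_def intro!: eq_matI dest: inj_onD[OF inj_on_digits])

lemma tmat_kronecker:
  "kronecker (tmat N k l G) (tmat N k' l' G') = tmat N (k + k') (l + l')
     (\<lambda>xs ys. G (take l xs) (take k ys) * G' (drop l xs) (drop k ys))"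
  (is "?L = ?R")
proof (rule eq_matI)
  fix r c assume "r < dim_row ?R" "c < dim_col ?R"
  then have rc: "r < N ^ (l + l')" "c < N ^ (k + k')" by simp_all
  then have pos: "0 < N ^ l'" "0 < N ^ k'" by (auto simp: power_add power_0_left intro!: gr0I split: if_splits)
  have "r div N ^ l' < N ^ l" "c div N ^ k' < N ^ k"
    using rc by (simp_all add: less_mult_imp_div_less power_add)
  then show "?L $$ (r, c) = ?R $$ (r, c)"
    using rc pos by (simp add: kronecker_def tmat_def power_add digits_append)
qed (simp_all add: kronecker_def power_add)

lemma tmat_mult:
  "tmat N l m G * tmat N k l H = tmat N k m (\<lambda>xs zs. \<Sum>ys\<in>words N l. G xs ys * H ys zs)"
proof (rule eq_matI)
  fix r c assume rc: "r < dim_row (tmat N k m (\<lambda>xs zs. \<Sum>ys\<in>words N l. G xs ys * H ys zs))"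
    "c < dim_col (tmat N k m (\<lambda>xs zs. \<Sum>ys\<in>words N l. G xs ys * H ys zs))"
  have "(\<Sum>i<N ^ l. G (digits N m r) (digits N l i) * H (digits N l i) (digits N k c)) =
      (\<Sum>ys\<in>words N l. G (digits N m r) ys * H ys (digits N k c))"
    by (rule sum.reindex_bij_betw[OF bij_betw_digits])
  then show "(tmat N l m G * tmat N k l H) $$ (r, c) =
      tmat N k m (\<lambda>xs zs. \<Sum>ys\<in>words N l. G xs ys * H ys zs) $$ (r, c)"
    using rc by (simp add: tmat_def scalar_prod_def atLeast0LessThan)
qed simp_all

lemma tmat_adjoint: "mat_adjoint (tmat N k l G) = tmat N l k (\<lambda>xs ys. cnj (G ys xs))"
  by (auto simp: mat_adjoint_def tmat_def mat_of_rows_def intro!: eq_matI)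

section \<open>Partitions as label lists\<close>

text \<open>The Kronecker symbol of the partition with labels \<open>ws\<close>, which gives the
  entries of its partition map. Only coincidences among labels count, not their values.\<close>

definition fits :: "nat list \<Rightarrow> nat list \<Rightarrow> bool" where
  "fits ws xs \<longleftrightarrow> (\<forall>i<length ws. \<forall>j<length ws. ws ! i = ws ! j \<longrightarrow> xs ! i = xs ! j)"

text \<open>A partition of \<open>k\<close> upper and \<open>l\<close> lower points is encoded by lists of block labels
  \<open>us\<close> and \<open>ls\<close>, both read from left to right. The rows of \<open>tmat\<close> belong to the lower points, whence
  the order \<open>ls @ us\<close>; the circular order of the points is \<open>us @ rev ls\<close>.\<close>

definition pmat :: "nat \<Rightarrow> nat list \<Rightarrow> nat list \<Rightarrow> complex mat" where
  "pmat N us ls = tmat N (length us) (length ls) (\<lambda>xs ys. of_bool (fits (ls @ us) (xs @ ys)))"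

definition crosses :: "nat list \<Rightarrow> bool" where
  "crosses w \<longleftrightarrow> (\<exists>i j m n. i < j \<and> j < m \<and> m < n \<and> n < length w \<and>
     w ! i = w ! m \<and> w ! j = w ! n \<and> w ! i \<noteq> w ! j)"

lemma crossesI:
  assumes "i < j" "j < m" "m < n" "n < length w" "w ! i = w ! m" "w ! j = w ! n" "w ! i \<noteq> w ! j"
  shows "crosses w"
  using assms unfolding crosses_def by blast

definition label_partition :: "'a set \<Rightarrow> ('a \<Rightarrow> nat) \<Rightarrow> 'a set set" where
  "label_partition S g = (\<lambda>x. {y \<in> S. g y = g x}) ` S"

lemma partition_on_label_partition: "partition_on S (label_partition S g)"
  by (rule partition_onI) (auto simp: label_partition_def disjnt_def)

lemma same_block_label_partition:
  "same_block (label_partition S g) x y \<longleftrightarrow> x \<in> S \<and> y \<in> S \<and> g x = g y"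
  by (auto simp: same_block_def label_partition_def)

text \<open>The finitely many blocks are numbered, and every point inherits the number of its
  block.\<close>

lemma partition_on_labels:
  assumes "partition_on S p" "finite S"
  obtains g :: "'a \<Rightarrow> nat" where "\<And>x y. same_block p x y \<longleftrightarrow> x \<in> S \<and> y \<in> S \<and> g x = g y"
proof -
  have "finite p" using assms by (metis finite_UnionD partition_on_def)
  then obtain h :: "'a set \<Rightarrow> nat" where h: "inj_on h p"
    using finite_imp_inj_to_nat_seg by blast
  define B where "B x = (THE B. B \<in> p \<and> x \<in> B)" for x
  have B: "B x = C" if "C \<in> p" "x \<in> C" for x C
    unfolding B_def using that assms(1)
    by (intro the_equality conjI) (blast dest: partition_onD2 disjointD)+
  have S: "\<exists>C\<in>p. x \<in> C" if "x \<in> S" for x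
    using that partition_onD1[OF assms(1)] by auto
  have sub: "C \<subseteq> S" if "C \<in> p" for C
    using that partition_onD1[OF assms(1)] by auto
  show ?thesis
  proof (rule that[of "h \<circ> B"])
    fix x y
    show "same_block p x y \<longleftrightarrow> x \<in> S \<and> y \<in> S \<and> (h \<circ> B) x = (h \<circ> B) y"
    proof
      assume "same_block p x y"
      then show "x \<in> S \<and> y \<in> S \<and> (h \<circ> B) x = (h \<circ> B) y"
        using sub B by (force simp: same_block_def)
    next
      assume *: "x \<in> S \<and> y \<in> S \<and> (h \<circ> B) x = (h \<circ> B) y"
      then obtain C D where CD: "C \<in> p" "x \<in> C" "D \<in> p" "y \<in> D" using S by blast
      then have "h C = h D" using * B by auto
      then have "C = D" using h CD by (auto dest: inj_onD)
      then show "same_block p x y" using CD by (auto simp: same_block_def)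
    qed
  qed
qed

lemma T_mat_eq_pmat:
  assumes p: "\<And>x y. same_block p x y \<longleftrightarrow>
    x \<in> {1..k} <+> {1..l} \<and> y \<in> {1..k} <+> {1..l} \<and> g x = g y"
  shows "T_mat N k l p = pmat N (map (g \<circ> Inl) [1..<Suc k]) (map (g \<circ> Inr) [1..<Suc l])"
proof -
  let ?S = "{1..k} <+> {1..l}"
  let ?lab = "map (g \<circ> Inr) [1..<Suc l] @ map (g \<circ> Inl) [1..<Suc k]"
  \<comment> \<open>The position of a point, counted from 0, in the list that has the lower points
    first. Labels and indices are both read off there.\<close>
  define e where "e = case_sum (\<lambda>x. l + x - 1) (\<lambda>y::nat. y - 1)"
  have e: "e ` ?S = {..<l + k}"
  proof
    show "{..<l + k} \<subseteq> e ` ?S"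
    proof
      fix i assume i: "i \<in> {..<l + k}"
      show "i \<in> e ` ?S"
      proof (cases "i < l")
        case True
        then have "i = e (Inr (Suc i))" "Inr (Suc i) \<in> ?S" by (auto simp: e_def)
        then show ?thesis by blast
      next
        case False
        then have "i = e (Inl (Suc i - l))" "Inl (Suc i - l) \<in> ?S" using i by (auto simp: e_def)
        then show ?thesis by blast
      qed
    qed
  qed (auto simp: e_def)
  have lab: "?lab ! e z = g z" if "z \<in> ?S" for z
    using that by (auto simp: e_def nth_append simp del: upt_Suc)
  have "(\<forall>x y. same_block p x y \<longrightarrow> case_sum (digit N k c) (digit N l r) x = case_sum (digit N k c) (digit N l r) y)
      \<longleftrightarrow> fits ?lab (digits N l r @ digits N k c)" for r c
  proof -
    let ?idx = "case_sum (digit N k c) (digit N l r)" and ?w = "digits N l r @ digits N k c"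
    have w: "?w ! e z = ?idx z" if "z \<in> ?S" for z
      using that by (auto simp: e_def nth_append digits_def simp del: upt_Suc)
    have "fits ?lab ?w \<longleftrightarrow> (\<forall>i\<in>e ` ?S. \<forall>j\<in>e ` ?S. ?lab ! i = ?lab ! j \<longrightarrow> ?w ! i = ?w ! j)"
      unfolding e fits_def by (auto simp del: upt_Suc)
    also have "\<dots> \<longleftrightarrow> (\<forall>x\<in>?S. \<forall>y\<in>?S. g x = g y \<longrightarrow> ?idx x = ?idx y)"
      using lab w by (auto simp del: upt_Suc)
    finally show ?thesis unfolding p by blast
  qed
  then show ?thesis
    unfolding T_mat_def pmat_def tmat_def by (auto simp: Let_def simp del: upt_Suc intro!: eq_matI)
qed

lemma pmat_eq_T_mat:
  fixes us ls :: "nat list"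
  defines "g \<equiv> case_sum (\<lambda>x. us ! (x - 1)) (\<lambda>y. ls ! (y - 1))"
  defines "p \<equiv> label_partition ({1..length us} <+> {1..length ls}) g"
  shows "pmat N us ls = T_mat N (length us) (length ls) p"
proof -
  have "us = map (g \<circ> Inl) [1..<Suc (length us)]" "ls = map (g \<circ> Inr) [1..<Suc (length ls)]"
    by (auto simp: g_def intro!: nth_equalityI simp del: upt_Suc)
  then show ?thesis
    using T_mat_eq_pmat[of p "length us" "length ls" g N] by (simp add: p_def same_block_label_partition)
qed

lemma T_mat_two_row_partitions:
  "T_mat N k l ` two_row_partitions k l = {pmat N us ls |us ls. length us = k \<and> length ls = l}"
proof
  show "T_mat N k l ` two_row_partitions k l \<subseteq> {pmat N us ls |us ls. length us = k \<and> length ls = l}"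
  proof
    fix A assume "A \<in> T_mat N k l ` two_row_partitions k l"
    then obtain p where p: "partition_on ({1..k} <+> {1..l}) p" "A = T_mat N k l p"
      by (auto simp: two_row_partitions_def)
    obtain g :: "nat + nat \<Rightarrow> nat" where "\<And>x y. same_block p x y \<longleftrightarrow>
        x \<in> {1..k} <+> {1..l} \<and> y \<in> {1..k} <+> {1..l} \<and> g x = g y"
      using partition_on_labels[OF p(1)] by (metis finite_Plus finite_atLeastAtMost)
    from T_mat_eq_pmat[OF this] p(2) show "A \<in> {pmat N us ls |us ls. length us = k \<and> length ls = l}"
      by (metis (mono_tags, lifting) diff_Suc_1 length_map length_upt mem_Collect_eq)
  qed
  show "{pmat N us ls |us ls. length us = k \<and> length ls = l} \<subseteq> T_mat N k l ` two_row_partitions k l"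
    by (auto simp: pmat_eq_T_mat two_row_partitions_def intro!: imageI partition_on_label_partition)
qed

lemma pmat_mem_NC_dual:
  assumes "\<not> crosses (us @ rev ls)"
  shows "pmat N us ls \<in> NC_dual N (length us) (length ls)"
proof -
  let ?k = "length us" and ?l = "length ls"
  let ?w = "us @ rev ls"
  define g where "g = case_sum (\<lambda>x. us ! (x - 1)) (\<lambda>y. ls ! (y - 1))"
  define p where "p = label_partition ({1..?k} <+> {1..?l}) g"
  interpret vectorspace class_ring "mat_space (N ^ ?l) (N ^ ?k)" by (rule matrix_vs)
  \<comment> \<open>\<open>circular_pos\<close> counts from 1 and list positions from 0, whence the
    subtraction. Reversing \<open>ls\<close> matches the right-to-left order of the lower
    points.\<close>
  have pos: "?w ! (circular_pos ?k ?l z - 1) = g z" "0 < circular_pos ?k ?l z"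
    "circular_pos ?k ?l z \<le> ?k + ?l"
    if "z \<in> {1..?k} <+> {1..?l}" for z
    using that by (auto simp: circular_pos_def g_def nth_append rev_nth)
  have "\<not> has_crossing (circular_pos ?k ?l) p"
  proof
    assume "has_crossing (circular_pos ?k ?l) p"
    then obtain x1 x2 x3 x4 where x:
      "circular_pos ?k ?l x1 < circular_pos ?k ?l x2" "circular_pos ?k ?l x2 < circular_pos ?k ?l x3"
      "circular_pos ?k ?l x3 < circular_pos ?k ?l x4"
      "same_block p x1 x3" "same_block p x2 x4" "\<not> same_block p x1 x2"
      by (auto simp: has_crossing_def)
    then have S: "x1 \<in> {1..?k} <+> {1..?l}" "x2 \<in> {1..?k} <+> {1..?l}"
      "x3 \<in> {1..?k} <+> {1..?l}" "x4 \<in> {1..?k} <+> {1..?l}"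
      "g x1 = g x3" "g x2 = g x4" "g x1 \<noteq> g x2"
      by (auto simp: p_def same_block_label_partition)
    have "crosses ?w"
    proof (rule crossesI)
      show "?w ! (circular_pos ?k ?l x1 - 1) = ?w ! (circular_pos ?k ?l x3 - 1)"
        "?w ! (circular_pos ?k ?l x2 - 1) = ?w ! (circular_pos ?k ?l x4 - 1)"
        by (simp_all only: pos S)
      show "?w ! (circular_pos ?k ?l x1 - 1) \<noteq> ?w ! (circular_pos ?k ?l x2 - 1)"
        using S(7) by (simp only: pos(1)[OF S(1)] pos(1)[OF S(2)] not_False_eq_True)
    next
      have "0 < circular_pos ?k ?l x1" "circular_pos ?k ?l x4 \<le> ?k + ?l" by (simp_all only: pos S)
      with x(1-3) show "circular_pos ?k ?l x1 - 1 < circular_pos ?k ?l x2 - 1"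
        "circular_pos ?k ?l x2 - 1 < circular_pos ?k ?l x3 - 1"
        "circular_pos ?k ?l x3 - 1 < circular_pos ?k ?l x4 - 1"
        "circular_pos ?k ?l x4 - 1 < length ?w"
        by (simp_all add: diff_less_mono less_imp_diff_less)
    qed
    then show False using assms by simp
  qed
  then have "p \<in> noncrossing_two_row_partitions ?k ?l"
    by (simp add: noncrossing_two_row_partitions_def two_row_partitions_def p_def
        partition_on_label_partition)
  moreover have "pmat N us ls = T_mat N ?k ?l p"
    unfolding p_def g_def by (rule pmat_eq_T_mat)
  ultimately have "pmat N us ls \<in> T_mat N ?k ?l ` noncrossing_two_row_partitions ?k ?l"
    by simp
  moreover have "T_mat N ?k ?l ` noncrossing_two_row_partitions ?k ?l \<subseteq> carrier (mat_space (N ^ ?l) (N ^ ?k))"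
    by (auto simp: T_mat_def matrix_vs_simps)
  ultimately show ?thesis
    unfolding NC_dual_def using in_own_span by blast
qed

lemma crossing_partition_labels:
  assumes "p \<in> crossing_partitions k"
  obtains ls where "length ls = k" "crosses ls" "xi N k p = pmat N [] ls"
proof -
  have p: "partition_on {1..k} p" and cr: "has_crossing (\<lambda>x. x) p"
    using assms by (auto simp: crossing_partitions_def partitions_def)
  obtain g :: "nat \<Rightarrow> nat" where g: "\<And>x y. same_block p x y \<longleftrightarrow> x \<in> {1..k} \<and> y \<in> {1..k} \<and> g x = g y"
    using partition_on_labels[OF p] by (metis finite_atLeastAtMost)
  \<comment> \<open>There are no upper points, so the value 0 on the left summand is a
    dummy.\<close>
  define h :: "nat + nat \<Rightarrow> nat" where "h = case_sum (\<lambda>_. 0) g"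
  have sb: "same_block ((`) Inr ` p) x y \<longleftrightarrow> (\<exists>u v. x = Inr u \<and> y = Inr v \<and> same_block p u v)"
    for x y :: "nat + nat"
    unfolding same_block_def by blast
  have "same_block ((`) Inr ` p) x y \<longleftrightarrow>
      x \<in> {1..0} <+> {1..k} \<and> y \<in> {1..0} <+> {1..k} \<and> h x = h y" for x y :: "nat + nat"
    unfolding sb g by (cases x; cases y) (auto simp: h_def)
  from T_mat_eq_pmat[OF this] have "xi N k p = pmat N [] (map g [1..<Suc k])"
    using assms by (simp add: xi_eq_T_mat crossing_partitions_def h_def comp_def del: upt_Suc)
  moreover have "crosses (map g [1..<Suc k])"
  proof -
    obtain x1 x2 x3 x4 where x: "x1 < x2" "x2 < x3" "x3 < x4"
      "same_block p x1 x3" "same_block p x2 x4" "\<not> same_block p x1 x2"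
      using cr by (auto simp: has_crossing_def)
    then have "x1 \<in> {1..k}" "x2 \<in> {1..k}" "x3 \<in> {1..k}" "x4 \<in> {1..k}"
      "g x1 = g x3" "g x2 = g x4" "g x1 \<noteq> g x2"
      by (auto simp: g)
    with x(1-3) show ?thesis
      by (intro crossesI[of "x1 - 1" "x2 - 1" "x3 - 1" "x4 - 1"])
        (simp_all add: diff_less_mono less_imp_diff_less del: upt_Suc)
  qed
  ultimately show ?thesis using that[of "map g [1..<Suc k]"] by (simp del: upt_Suc)
qed

section \<open>Permutation invariance\<close>

definition first_index :: "nat list \<Rightarrow> nat \<Rightarrow> nat" where
  "first_index w x = length (takeWhile (\<lambda>y. y \<noteq> x) w)"

text \<open>A canonical labelling of the kernel of \<open>w\<close>: each block is named by its
  first position. Labels may therefore skip numbers, as in \<open>[0, 0, 2, 0, 2]\<close>, unlike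
  those of restricted growth strings.\<close>

definition normal_form :: "nat list \<Rightarrow> nat list" where
  "normal_form w = map (first_index w) w"

lemma length_normal [simp]: "length (normal_form w) = length w"
  by (simp add: normal_form_def)

lemma first_index_simps [simp]:
  "first_index (a # w) x = (if a = x then 0 else Suc (first_index w x))"
  by (simp add: first_index_def)

lemma nth_first_index: "x \<in> set w \<Longrightarrow> w ! first_index w x = x"
  by (induction w) auto

lemma first_index_less: "x \<in> set w \<Longrightarrow> first_index w x < length w"
  by (induction w) auto

lemma nth_less_first_index: "j < first_index w x \<Longrightarrow> w ! j \<noteq> x"
  by (induction w arbitrary: j) (auto simp: first_index_def nth_Cons split: nat.splits if_splits)

lemma first_index_eqI:
  assumes "m < length w" "w ! m = x" "\<And>j. j < m \<Longrightarrow> w ! j \<noteq> x"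
  shows "first_index w x = m"
proof (rule linorder_cases[of "first_index w x" m])
  assume "first_index w x < m"
  then show ?thesis using assms nth_first_index[of x w] by (metis nth_mem)
next
  assume "m < first_index w x"
  then show ?thesis using assms(2) nth_less_first_index by blast
qed

lemma normal_nth_eq_iff:
  assumes "i < length w" "j < length w"
  shows "normal_form w ! i = normal_form w ! j \<longleftrightarrow> w ! i = w ! j"
proof -
  have "first_index w (w ! i) = first_index w (w ! j) \<longleftrightarrow> w ! i = w ! j"
    using assms by (metis nth_first_index nth_mem)
  then show ?thesis using assms by (simp add: normal_form_def)
qed

lemma normal_eq_iff:
  assumes "length w = length w'"
  shows "normal_form w = normal_form w' \<longleftrightarrow> (\<forall>i<length w. \<forall>j<length w. w ! i = w ! j \<longleftrightarrow> w' ! i = w' ! j)"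
proof
  assume "normal_form w = normal_form w'"
  then show "\<forall>i<length w. \<forall>j<length w. w ! i = w ! j \<longleftrightarrow> w' ! i = w' ! j"
    using assms by (metis normal_nth_eq_iff)
next
  assume *: "\<forall>i<length w. \<forall>j<length w. w ! i = w ! j \<longleftrightarrow> w' ! i = w' ! j"
  show "normal_form w = normal_form w'"
  proof (rule nth_equalityI)
    fix i assume "i < length (normal_form w)"
    then have i: "i < length w" by simp
    let ?m = "first_index w (w ! i)"
    have m: "?m < length w" "w ! ?m = w ! i" using i by (simp_all add: first_index_less nth_first_index)
    have "first_index w' (w' ! i) = ?m"
    proof (rule first_index_eqI)
      fix j assume "j < ?m"
      then have "j < length w" "w ! j \<noteq> w ! i" using m by (auto dest: nth_less_first_index)
      then show "w' ! j \<noteq> w' ! i" using * i by blast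
    qed (use m * i assms in auto)
    then show "normal_form w ! i = normal_form w' ! i" using i assms by (simp add: normal_form_def)
  qed (simp add: assms)
qed

lemma normal_form_idem [simp]: "normal_form (normal_form w) = normal_form w"
  by (subst normal_eq_iff) (simp_all add: normal_nth_eq_iff)

lemma fits_normal_left [simp]: "fits (normal_form ws) xs \<longleftrightarrow> fits ws xs"
  by (auto simp: fits_def normal_nth_eq_iff)

lemma fits_normal_right: "length ws \<le> length xs \<Longrightarrow> fits ws (normal_form xs) \<longleftrightarrow> fits ws xs"
  by (auto simp: fits_def normal_nth_eq_iff)

lemma crosses_normal [simp]: "crosses (normal_form w) \<longleftrightarrow> crosses w"
  by (simp add: crosses_def normal_nth_eq_iff cong: conj_cong)

definition normal_words :: "nat \<Rightarrow> nat list set" where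
  "normal_words n = normal_form ` {w. length w = n}"

lemma normal_words_subset: "normal_words n \<subseteq> words n n"
  by (auto simp: normal_words_def words_def normal_form_def first_index_less)

lemma finite_normal_words [simp]: "finite (normal_words n)"
  using normal_words_subset finite_words by (rule finite_subset)

lemma normal_mem [simp]: "length w = n \<Longrightarrow> normal_form w \<in> normal_words n"
  by (auto simp: normal_words_def)

lemma normal_wordsD: "w \<in> normal_words n \<Longrightarrow> length w = n \<and> normal_form w = w"
  by (auto simp: normal_words_def)

text \<open>Matching the letters of \<open>w\<close> and \<open>w'\<close> at equal positions is a
  bijection because the kernels agree. The complements in \<open>{..<N}\<close> then have equal
  size, and a bijection between them completes the permutation.\<close>

lemma same_kernel_permutes:
  assumes w: "w \<in> words N n" "w' \<in> words N n" and eq: "normal_form w = normal_form w'"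
  obtains \<sigma> where "\<sigma> permutes {..<N}" "map \<sigma> w = w'"
proof -
  have len: "length w = n" "length w' = n" and sub: "set w \<subseteq> {..<N}" "set w' \<subseteq> {..<N}"
    using w by (auto simp: words_def)
  have ker: "w ! i = w ! j \<longleftrightarrow> w' ! i = w' ! j" if "i < n" "j < n" for i j
    using eq normal_eq_iff[of w w'] len that by simp
  define f where "f x = w' ! first_index w x" for x
  have f: "f (w ! i) = w' ! i" if "i < n" for i
  proof -
    have "first_index w (w ! i) < n" "w ! first_index w (w ! i) = w ! i"
      using that len by (metis first_index_less nth_mem, metis nth_first_index nth_mem)
    then show ?thesis using ker[of "first_index w (w ! i)" i] that by (simp add: f_def)
  qed
  have "bij_betw f (set w) (set w')"
    unfolding bij_betw_def
  proof
    show "inj_on f (set w)"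
      using len ker f by (auto simp: inj_on_def in_set_conv_nth)
    show "f ` set w = set w'"
      using len f by (force simp: set_conv_nth image_iff)
  qed
  moreover obtain g where "bij_betw g ({..<N} - set w) ({..<N} - set w')"
  proof -
    have "card (set w) = card (set w')" using calculation by (rule bij_betw_same_card)
    then have "card ({..<N} - set w) = card ({..<N} - set w')"
      using sub by (simp add: card_Diff_subset)
    then obtain g where "bij_betw g ({..<N} - set w) ({..<N} - set w')"
      using finite_same_card_bij[of "{..<N} - set w" "{..<N} - set w'"] by auto
    then show ?thesis by (rule that)
  qed
  ultimately have "bij_betw (\<lambda>x. if x \<in> set w then f x else g x) (set w \<union> ({..<N} - set w)) (set w' \<union> ({..<N} - set w'))"
    by (intro bij_betw_disjoint_Un) auto
  then have h: "bij_betw (\<lambda>x. if x \<in> set w then f x else g x) {..<N} {..<N}"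
    using sub by (simp add: Un_absorb1)
  define \<sigma> where "\<sigma> x = (if x \<in> {..<N} then if x \<in> set w then f x else g x else x)" for x
  have "bij_betw \<sigma> {..<N} {..<N}" using h by (rule bij_betw_cong[THEN iffD1, rotated]) (simp add: \<sigma>_def)
  then have "\<sigma> permutes {..<N}" by (rule bij_imp_permutes) (simp add: \<sigma>_def)
  moreover have "map \<sigma> w = w'"
    using len sub f by (intro nth_equalityI) (auto simp: \<sigma>_def subset_iff)
  ultimately show ?thesis by (rule that)
qed

text \<open>Here \<open>d\<close> is coarser than \<open>c\<close>, so the labels of
  \<open>c\<close> map onto those of \<open>d\<close>. Were this map injective, the kernels and
  hence the normal forms would coincide.\<close>

lemma fits_card_less:
  assumes c: "c \<in> normal_words n" and d: "d \<in> normal_words n" and cd: "fits c d" "c \<noteq> d"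
  shows "card (set d) < card (set c)"
proof -
  have len: "length c = n" "length d = n" using c d by (auto dest: normal_wordsD)
  define f where "f x = d ! first_index c x" for x
  have f: "f (c ! i) = d ! i" if "i < n" for i
    using that len cd(1) unfolding f_def fits_def
    by (metis first_index_less nth_first_index nth_mem)
  then have im: "f ` set c = set d"
    using len by (force simp: set_conv_nth image_iff)
  have "card (set d) \<noteq> card (set c)"
  proof
    assume "card (set d) = card (set c)"
    then have "inj_on f (set c)" using im by (simp add: inj_on_iff_eq_card)
    then have "\<forall>i<n. \<forall>j<n. c ! i = c ! j \<longleftrightarrow> d ! i = d ! j"
      using f len by (metis inj_on_eq_iff nth_mem)
    then have "normal_form c = normal_form d" using len by (simp add: normal_eq_iff)
    then show False using normal_wordsD[OF c] normal_wordsD[OF d] cd(2) by simp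
  qed
  moreover have "card (set d) \<le> card (set c)" unfolding im[symmetric] by (rule card_image_le) simp
  ultimately show ?thesis by simp
qed

section \<open>The span of all partition maps as the space of invariant matrices\<close>

lemma subspace_tmat_sum:
  assumes W: "VectorSpace.subspace class_ring W (mat_space (N ^ l) (N ^ k))"
    and "finite I" and G: "\<And>i. i \<in> I \<Longrightarrow> tmat N k l (G i) \<in> W"
  shows "tmat N k l (\<lambda>xs ys. \<Sum>i\<in>I. c i * G i xs ys) \<in> W"
  using assms(2) G
proof (induction I)
  case empty
  then show ?case using W by (simp add: subspace_mat_iff flip: tmat_zero)
next
  case (insert i I)
  have "tmat N k l (\<lambda>xs ys. \<Sum>j\<in>insert i I. c j * G j xs ys) =
      c i \<cdot>\<^sub>m tmat N k l (G i) + tmat N k l (\<lambda>xs ys. \<Sum>j\<in>I. c j * G j xs ys)"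
    using insert.hyps by (simp add: tmat_add tmat_smult)
  then show ?case using W insert by (simp add: subspace_mat_iff)
qed

lemma P_dual_span:
  shows "VectorSpace.subspace class_ring (P_dual N k l) (mat_space (N ^ l) (N ^ k))"
    and "length us = k \<Longrightarrow> length ls = l \<Longrightarrow> pmat N us ls \<in> P_dual N k l"
    and "VectorSpace.subspace class_ring W (mat_space (N ^ l) (N ^ k)) \<Longrightarrow>
      (\<And>us ls. length us = k \<Longrightarrow> length ls = l \<Longrightarrow> pmat N us ls \<in> W) \<Longrightarrow> P_dual N k l \<subseteq> W"
proof -
  interpret vectorspace class_ring "mat_space (N ^ l) (N ^ k)" by (rule matrix_vs)
  let ?S = "{pmat N us ls |us ls. length us = k \<and> length ls = l}"
  have S: "?S \<subseteq> carrier (mat_space (N ^ l) (N ^ k))"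
    by (auto simp: pmat_def matrix_vs_simps)
  have P: "P_dual N k l = span ?S" by (simp add: P_dual_def T_mat_two_row_partitions)
  show "VectorSpace.subspace class_ring (P_dual N k l) (mat_space (N ^ l) (N ^ k))"
    unfolding P using S by (rule span_is_subspace)
  show "pmat N us ls \<in> P_dual N k l" if "length us = k" "length ls = l" for us ls
    unfolding P using that in_own_span[OF S] by blast
  show "P_dual N k l \<subseteq> W" if W: "VectorSpace.subspace class_ring W (mat_space (N ^ l) (N ^ k))"
    and "\<And>us ls. length us = k \<Longrightarrow> length ls = l \<Longrightarrow> pmat N us ls \<in> W"
  proof -
    have "?S \<subseteq> W" using that(2) by blast
    then show ?thesis unfolding P using span_is_subset[OF _ subspace.submod[OF W]] by simp
  qed
qed

definition invariant :: "nat \<Rightarrow> nat \<Rightarrow> nat \<Rightarrow> (nat list \<Rightarrow> nat list \<Rightarrow> complex) \<Rightarrow> bool" where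
  "invariant N k l G \<longleftrightarrow> (\<forall>\<sigma> xs ys. \<sigma> permutes {..<N} \<longrightarrow> xs \<in> words N l \<longrightarrow> ys \<in> words N k \<longrightarrow>
     G (map \<sigma> xs) (map \<sigma> ys) = G xs ys)"

text \<open>Moebius inversion on the partition lattice, by induction on the number of blocks: the indicator
  of the words with kernel \<open>c\<close> is the partition map of \<open>c\<close> minus the indicators of the strictly
  coarser kernels.\<close>

lemma kernel_indicator_mem_P_dual:
  assumes "c \<in> normal_words (k + l)"
  shows "tmat N k l (\<lambda>xs ys. of_bool (normal_form (xs @ ys) = c)) \<in> P_dual N k l"
  using assms
proof (induction "card (set c)" arbitrary: c rule: less_induct)
  case less
  define D where "D = {d \<in> normal_words (k + l). fits c d}"
  have c: "length c = k + l" "normal_form c = c" using less.prems by (auto dest: normal_wordsD)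
  then have "c \<in> D" using less.prems by (simp add: D_def fits_def)
  have fin: "finite D" by (simp add: D_def)
  have X: "tmat N k l (\<lambda>xs ys. of_bool (fits c (xs @ ys))) \<in> P_dual N k l"
    using P_dual_span(2)[of "drop l c" k "take l c" l N] c by (simp add: pmat_def)
  have "tmat N k l (\<lambda>xs ys. of_bool (normal_form (xs @ ys) = d)) \<in> P_dual N k l" if "d \<in> D - {c}" for d
    using less.hyps[of d] fits_card_less[OF less.prems, of d] that by (auto simp: D_def)
  then have "tmat N k l (\<lambda>xs ys. \<Sum>d\<in>D - {c}. - 1 * of_bool (normal_form (xs @ ys) = d)) \<in> P_dual N k l"
    using fin by (intro subspace_tmat_sum P_dual_span) auto
  then have "tmat N k l (\<lambda>xs ys. of_bool (fits c (xs @ ys))) +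
      tmat N k l (\<lambda>xs ys. \<Sum>d\<in>D - {c}. - 1 * of_bool (normal_form (xs @ ys) = d)) \<in> P_dual N k l"
    using X P_dual_span(1)[of N k l] unfolding subspace_mat_iff by blast
  also have "tmat N k l (\<lambda>xs ys. of_bool (fits c (xs @ ys))) +
      tmat N k l (\<lambda>xs ys. \<Sum>d\<in>D - {c}. - 1 * of_bool (normal_form (xs @ ys) = d)) =
      tmat N k l (\<lambda>xs ys. of_bool (normal_form (xs @ ys) = c))"
    unfolding tmat_add
  proof (rule tmat_cong)
    fix xs ys assume "xs \<in> words N l" "ys \<in> words N k"
    then have w: "length (xs @ ys) = k + l" by (simp add: words_def)
    have "of_bool (fits c (xs @ ys)) = (\<Sum>d\<in>D. of_bool (normal_form (xs @ ys) = d) :: complex)"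
    proof -
      have "fits c (xs @ ys) \<longleftrightarrow> normal_form (xs @ ys) \<in> D"
        using w c by (simp add: D_def fits_normal_right)
      then show ?thesis using fin by (simp add: of_bool_def)
    qed
    also have "\<dots> = of_bool (normal_form (xs @ ys) = c) + (\<Sum>d\<in>D - {c}. of_bool (normal_form (xs @ ys) = d))"
      by (rule sum.remove[OF fin \<open>c \<in> D\<close>])
    finally show "of_bool (fits c (xs @ ys)) + (\<Sum>d\<in>D - {c}. - 1 * of_bool (normal_form (xs @ ys) = d)) =
        (of_bool (normal_form (xs @ ys) = c) :: complex)"
      by (simp add: sum_negf)
  qed
  finally show ?case .
qed

text \<open>Words with equal kernels lie in one orbit of the permutations, so an invariant
  \<open>G\<close> depends on the kernel only and is a combination of kernel indicators.\<close>

lemma invariant_mem_P_dual: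
  assumes "invariant N k l G"
  shows "tmat N k l G \<in> P_dual N k l"
proof -
  \<comment> \<open>For a kernel with more than \<open>N\<close> blocks there is no such word and
    \<open>rep c\<close> is arbitrary; the indicator of that kernel is zero on all words.\<close>
  define rep where "rep c = (SOME w. w \<in> words N (k + l) \<and> normal_form w = c)" for c
  have "tmat N k l (\<lambda>xs ys. \<Sum>c\<in>normal_words (k + l). G (take l (rep c)) (drop l (rep c)) *
      of_bool (normal_form (xs @ ys) = c)) \<in> P_dual N k l"
    by (intro subspace_tmat_sum P_dual_span kernel_indicator_mem_P_dual) auto
  also have "tmat N k l (\<lambda>xs ys. \<Sum>c\<in>normal_words (k + l). G (take l (rep c)) (drop l (rep c)) *
      of_bool (normal_form (xs @ ys) = c)) = tmat N k l G"
  proof (rule tmat_cong)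
    fix xs ys assume xy: "xs \<in> words N l" "ys \<in> words N k"
    let ?c = "normal_form (xs @ ys)"
    have w: "xs @ ys \<in> words N (k + l)" using xy by (auto simp: words_def)
    have "rep ?c \<in> words N (k + l) \<and> normal_form (rep ?c) = ?c"
      unfolding rep_def by (rule someI[of _ "xs @ ys"]) (simp add: w)
    then obtain \<sigma> where \<sigma>: "\<sigma> permutes {..<N}" "map \<sigma> (xs @ ys) = rep ?c"
      using same_kernel_permutes[OF w] by metis
    have "take l (rep ?c) = map \<sigma> xs" "drop l (rep ?c) = map \<sigma> ys"
      using xy by (simp_all add: words_def flip: \<sigma>(2))
    then have "G (take l (rep ?c)) (drop l (rep ?c)) = G xs ys"
      using assms \<sigma>(1) xy by (simp add: invariant_def)
    moreover have "?c \<in> normal_words (k + l)" using w by (simp add: words_def)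
    ultimately show "(\<Sum>c\<in>normal_words (k + l). G (take l (rep c)) (drop l (rep c)) *
      of_bool (normal_form (xs @ ys) = c)) = G xs ys"
      by (simp add: of_bool_def if_distrib[of "(*) _"] cong: if_cong)
  qed
  finally show ?thesis .
qed

lemma map_permutes_words:
  "\<sigma> permutes {..<N} \<Longrightarrow> map \<sigma> xs \<in> words N k \<longleftrightarrow> xs \<in> words N k"
  unfolding words_def using permutes_in_image by (fastforce simp: subset_iff)

lemma map_permutes_eq_iff: "\<sigma> permutes S \<Longrightarrow> map \<sigma> xs = map \<sigma> ys \<longleftrightarrow> xs = ys"
  by (metis inj_map_eq_map permutes_inj)

lemma P_dual_eq_invariant: "P_dual N k l = {tmat N k l G |G. invariant N k l G}"
proof
  let ?W = "{tmat N k l G |G. invariant N k l G}"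
  show "P_dual N k l \<subseteq> ?W"
  proof (rule P_dual_span(3))
    have "\<exists>G. 0\<^sub>m (N ^ l) (N ^ k) = tmat N k l G \<and> invariant N k l G"
      unfolding tmat_zero invariant_def by (intro exI[of _ "\<lambda>_ _. 0"]) simp
    moreover have "\<exists>F. tmat N k l G + tmat N k l H = tmat N k l F \<and> invariant N k l F"
      if "invariant N k l G" "invariant N k l H" for G H
      using that unfolding tmat_add invariant_def
      by (intro exI[of _ "\<lambda>xs ys. G xs ys + H xs ys"]) simp
    moreover have "\<exists>F. c \<cdot>\<^sub>m tmat N k l G = tmat N k l F \<and> invariant N k l F"
      if "invariant N k l G" for G c
      using that unfolding tmat_smult invariant_def
      by (intro exI[of _ "\<lambda>xs ys. c * G xs ys"]) simp
    ultimately show "VectorSpace.subspace class_ring ?W (mat_space (N ^ l) (N ^ k))"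
      unfolding subspace_mat_iff by auto
    fix us ls :: "nat list" assume *: "length us = k" "length ls = l"
    have "invariant N k l (\<lambda>xs ys. of_bool (fits (ls @ us) (xs @ ys)))"
      unfolding invariant_def
    proof (intro allI impI)
      fix \<sigma> :: "nat \<Rightarrow> nat" and xs ys
      assume "\<sigma> permutes {..<N}" "xs \<in> words N l" "ys \<in> words N k"
      then have "length (ls @ us) = length (xs @ ys)" "inj \<sigma>" using * by (auto simp: words_def permutes_inj)
      then have "fits (ls @ us) (map \<sigma> (xs @ ys)) = fits (ls @ us) (xs @ ys)"
        unfolding fits_def by (simp add: inj_eq del: map_append)
      then show "(of_bool (fits (ls @ us) (map \<sigma> xs @ map \<sigma> ys)) :: complex) = of_bool (fits (ls @ us) (xs @ ys))"
        by simp
    qed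
    then show "pmat N us ls \<in> ?W" using * by (auto simp: pmat_def)
  qed
  show "?W \<subseteq> P_dual N k l" by (auto intro: invariant_mem_P_dual)
qed

lemma cap_eq_tmat:
  "mat 1 (N ^ 2) (\<lambda>(_, c). if digit N 2 c 1 = digit N 2 c 2 then 1 else 0) =
     tmat N 2 0 (\<lambda>_ ys. of_bool (ys ! 0 = ys ! 1))"
  by (auto simp: tmat_def digits_def upt_rec numeral_2_eq_2 intro!: eq_matI)

text \<open>Closure is checked on invariant functions, which avoids composing partition diagrams and
  counting the closed components that composition removes.\<close>

lemma tannaka_krein_dual_P_dual: "tannaka_krein_dual N (P_dual N)"
  unfolding tannaka_krein_dual_def
proof (intro conjI allI ballI)
  show "VectorSpace.subspace class_ring (P_dual N k l) (mat_space (N ^ l) (N ^ k))" for k l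
    by (rule P_dual_span)
  show "kronecker A B \<in> P_dual N (k + k') (l + l')"
    if AB: "A \<in> P_dual N k l" "B \<in> P_dual N k' l'" for k l k' l' A B
  proof -
    obtain G H where GH: "A = tmat N k l G" "invariant N k l G" "B = tmat N k' l' H" "invariant N k' l' H"
      using AB by (auto simp: P_dual_eq_invariant)
    have td: "take a xs \<in> words N a \<and> drop a xs \<in> words N b" if "xs \<in> words N (a + b)" for a b xs
      using that words_append_iff[of "take a xs" a "drop a xs" N b] by (simp add: words_def)
    have "invariant N (k + k') (l + l') (\<lambda>xs ys. G (take l xs) (take k ys) * H (drop l xs) (drop k ys))"
      using GH(2,4) td unfolding invariant_def by (simp add: take_map drop_map)
    then show ?thesis unfolding GH(1,3) tmat_kronecker by (rule invariant_mem_P_dual)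
  qed
  show "A * B \<in> P_dual N k m"
    if AB: "A \<in> P_dual N l m" "B \<in> P_dual N k l" for k l m A B
  proof -
    obtain G H where GH: "A = tmat N l m G" "invariant N l m G" "B = tmat N k l H" "invariant N k l H"
      using AB by (auto simp: P_dual_eq_invariant)
    have "invariant N k m (\<lambda>xs zs. \<Sum>ys\<in>words N l. G xs ys * H ys zs)"
      unfolding invariant_def
    proof (intro allI impI)
      fix \<sigma> :: "nat \<Rightarrow> nat" and xs zs
      assume *: "\<sigma> permutes {..<N}" "xs \<in> words N m" "zs \<in> words N k"
      \<comment> \<open>As \<sigma> permutes the intermediate words, it can be applied to the
        summation index; the invariance of both factors then removes it.\<close>
      have "bij_betw (map \<sigma>) (words N l) (words N l)"
        unfolding bij_betw_def
      proof
        show "inj_on (map \<sigma>) (words N l)" using *(1) by (auto simp: inj_on_def map_permutes_eq_iff)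
        show "map \<sigma> ` words N l = words N l"
        proof
          show "words N l \<subseteq> map \<sigma> ` words N l"
          proof
            fix ys assume ys: "ys \<in> words N l"
            have "ys = map \<sigma> (map (Hilbert_Choice.inv \<sigma>) ys)"
              using *(1) by (simp add: comp_def permutes_inverses)
            then show "ys \<in> map \<sigma> ` words N l"
              using ys map_permutes_words[OF permutes_inv[OF *(1)]] by blast
          qed
        qed (use *(1) in \<open>auto simp: map_permutes_words\<close>)
      qed
      from sum.reindex_bij_betw[OF this, of "\<lambda>ys. G (map \<sigma> xs) ys * H ys (map \<sigma> zs)"]
      show "(\<Sum>ys\<in>words N l. G (map \<sigma> xs) ys * H ys (map \<sigma> zs)) = (\<Sum>ys\<in>words N l. G xs ys * H ys zs)"
        using GH(2,4) * unfolding invariant_def by simp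
    qed
    then show ?thesis unfolding GH(1,3) tmat_mult by (rule invariant_mem_P_dual)
  qed
  show "mat_adjoint A \<in> P_dual N l k" if A: "A \<in> P_dual N k l" for k l A
  proof -
    obtain G where G: "A = tmat N k l G" "invariant N k l G" using A by (auto simp: P_dual_eq_invariant)
    have "invariant N l k (\<lambda>xs ys. cnj (G ys xs))" using G(2) by (simp add: invariant_def)
    then show ?thesis unfolding G(1) tmat_adjoint by (rule invariant_mem_P_dual)
  qed
  have "invariant N 1 1 (\<lambda>xs ys. of_bool (xs = ys))"
    by (simp add: invariant_def map_permutes_eq_iff)
  then show "1\<^sub>m N \<in> P_dual N 1 1"
    using tmat_one[of N 1] invariant_mem_P_dual by simp
  have "invariant N 2 0 (\<lambda>_ ys. of_bool (ys ! 0 = ys ! 1))"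
    by (auto simp: invariant_def words_def inj_eq dest!: permutes_inj)
  then show "mat 1 (N ^ 2) (\<lambda>(_, c). if digit N 2 c 1 = digit N 2 c 2 then 1 else 0) \<in> P_dual N 2 0"
    unfolding cap_eq_tmat by (rule invariant_mem_P_dual)
qed

lemma NC_dual_le_P_dual: "NC_dual N \<le> P_dual N"
proof (intro le_funI)
  fix k l
  interpret vectorspace class_ring "mat_space (N ^ l) (N ^ k)" by (rule matrix_vs)
  show "NC_dual N k l \<subseteq> P_dual N k l"
    unfolding NC_dual_def P_dual_def
    by (intro span_is_monotone image_mono) (auto simp: noncrossing_two_row_partitions_def)
qed

section \<open>Duals containing the crossing\<close>

lemma fits_zip:
  assumes "length ws = length xs"
  shows "fits ws xs \<longleftrightarrow>
    (\<forall>p\<in>set (zip ws xs). \<forall>q\<in>set (zip ws xs). fst p = fst q \<longrightarrow> snd p = snd q)"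
proof -
  have "set (zip ws xs) = (\<lambda>i. (ws ! i, xs ! i)) ` {..<length ws}"
    using assms by (auto simp: set_zip)
  then show ?thesis by (auto simp: fits_def)
qed

lemma fits_three: "fits [c, c, c] [x, y, z] \<longleftrightarrow> x = y \<and> x = z"
  by (simp add: fits_zip) metis

lemma fits_crossing: "a \<noteq> b \<Longrightarrow> fits [a, b, a, b] [x, y, z, w] \<longleftrightarrow> x = z \<and> y = w"
  by (simp add: fits_zip) metis

lemma sum_eq_single:
  assumes "finite A" "a \<in> A" "\<And>x. x \<in> A \<Longrightarrow> x \<noteq> a \<Longrightarrow> f x = 0"
  shows "sum f A = f a"
  using assms by (subst sum.remove[of A a]) (auto intro: sum.neutral)

text \<open>Insertion sort: \<open>move\<close> carries the required entry to the left past a block,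
  and the prefix \<open>ps\<close> holds what is already in place.\<close>

lemma adjacent_swaps:
  assumes swap: "\<And>us p q vs. Q (us @ p # q # vs) \<Longrightarrow> Q (us @ q # p # vs)"
    and "mset us = mset vs" "Q us"
  shows "Q vs"
proof -
  have move: "Q (ps @ a # us @ vs)" if "Q (ps @ us @ a # vs)" for ps us a vs
    using that
  proof (induction us arbitrary: vs rule: rev_induct)
    case (snoc b us)
    then have "Q ((ps @ us) @ a # b # vs)" using swap[of "ps @ us" b a vs] by simp
    then show ?case using snoc.IH[of "b # vs"] by simp
  qed simp
  have "Q (ps @ us) \<Longrightarrow> mset us = mset vs \<Longrightarrow> Q (ps @ vs)" for ps
  proof (induction vs arbitrary: us ps)
    case (Cons a vs)
    then have "a \<in> set us" by (metis list.set_intros(1) set_mset_mset)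
    then obtain xs ys where us: "us = xs @ a # ys" by (metis split_list)
    then have "Q ((ps @ [a]) @ (xs @ ys))" using Cons.prems move[of ps xs a ys] by simp
    moreover have "mset (xs @ ys) = mset vs" using Cons.prems us by simp
    ultimately have "Q ((ps @ [a]) @ vs)" by (rule Cons.IH)
    then show ?case by simp
  qed simp
  from this[of "[]"] show ?thesis using assms by simp
qed

text \<open>Around the circle the labels rise along the upper row and fall along the reversed lower
  row. In such a unimodal sequence a pattern a, b, a, b forces a = b, wherever the peak
  lies.\<close>

lemma not_crosses_sorted:
  assumes "sorted us" "sorted ls"
  shows "\<not> crosses (us @ rev ls)"
proof
  assume "crosses (us @ rev ls)"
  then obtain i j m n where ijmn: "i < j" "j < m" "m < n" "n < length (us @ rev ls)"
    and eq: "(us @ rev ls) ! i = (us @ rev ls) ! m" "(us @ rev ls) ! j = (us @ rev ls) ! n"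
      "(us @ rev ls) ! i \<noteq> (us @ rev ls) ! j"
    unfolding crosses_def by blast
  have up: "(us @ rev ls) ! a \<le> (us @ rev ls) ! b" if "a \<le> b" "b < length us" for a b
    using that assms(1) by (simp add: nth_append sorted_nth_mono)
  have down: "(us @ rev ls) ! b \<le> (us @ rev ls) ! a" if "length us \<le> a" "a \<le> b" "b < length (us @ rev ls)" for a b
    using that assms(2) by (simp add: nth_append rev_nth sorted_nth_mono diff_less_Suc Suc_diff_le)
  consider "m < length us" | "length us \<le> j" | "j < length us" "length us \<le> m" by linarith
  then show False
  proof cases
    case 1
    then show ?thesis using up[of i j] up[of j m] ijmn eq by simp
  next
    case 2
    then show ?thesis using down[of j m] down[of m n] ijmn eq by simp
  next
    case 3
    then show ?thesis using up[of i j] down[of m n] ijmn eq by simp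
  qed
qed

section \<open>Operations inside a dual above the noncrossing one\<close>

locale intermediate_dual =
  fixes N :: nat and C :: hom_family
  assumes dual: "tannaka_krein_dual N C" and NC_le: "NC_dual N \<le> C"
begin

lemma
  shows subspace: "VectorSpace.subspace class_ring (C k l) (mat_space (N ^ l) (N ^ k))"
    and kronecker_mem: "A \<in> C k l \<Longrightarrow> B \<in> C k' l' \<Longrightarrow> kronecker A B \<in> C (k + k') (l + l')"
    and mult_mem: "A' \<in> C l m \<Longrightarrow> A \<in> C k l \<Longrightarrow> A' * A \<in> C k m"
    and adjoint_mem: "A \<in> C k l \<Longrightarrow> mat_adjoint A \<in> C l k"
    and cap_mem: "tmat N 2 0 (\<lambda>_ ys. of_bool (ys ! 0 = ys ! 1)) \<in> C 2 0"
    and one_mem: "1\<^sub>m N \<in> C 1 1"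
  using dual unfolding tannaka_krein_dual_def cap_eq_tmat by metis+

lemma noncrossing_mem: "\<not> crosses (us @ rev ls) \<Longrightarrow> pmat N us ls \<in> C (length us) (length ls)"
  using pmat_mem_NC_dual[of us ls N] NC_le by (auto simp: le_fun_def)

lemma id_mem: "tmat N k k (\<lambda>xs ys. of_bool (xs = ys)) \<in> C k k"
proof (induction k)
  case 0
  \<comment> \<open>The empty partition supplies the identity on zero strands.\<close>
  have "pmat N [] [] \<in> C 0 0" using noncrossing_mem[of "[]" "[]"] by (simp add: crosses_def)
  also have "pmat N [] [] = tmat N 0 0 (\<lambda>xs ys. of_bool (xs = ys))"
    unfolding pmat_def by (auto simp: fits_def intro!: tmat_cong)
  finally show ?case .
next
  case (Suc k)
  have "kronecker (tmat N 1 1 (\<lambda>xs ys. of_bool (xs = ys))) (tmat N k k (\<lambda>xs ys. of_bool (xs = ys))) \<in> C (1 + k) (1 + k)"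
    using one_mem Suc tmat_one[of N 1] by (intro kronecker_mem) simp_all
  also have "kronecker (tmat N 1 1 (\<lambda>xs ys. of_bool (xs = ys))) (tmat N k k (\<lambda>xs ys. of_bool (xs = ys))) =
      tmat N (1 + k) (1 + k) (\<lambda>xs ys. of_bool (xs = ys))"
    unfolding tmat_kronecker
  proof (rule tmat_cong)
    fix xs ys :: "nat list"
    have "xs = ys \<longleftrightarrow> take 1 xs = take 1 ys \<and> drop 1 xs = drop 1 ys"
      by (metis append_take_drop_id)
    then show "of_bool (take 1 xs = take 1 ys) * of_bool (drop 1 xs = drop 1 ys) = (of_bool (xs = ys) :: complex)"
      by simp
  qed
  finally show ?case by simp
qed

text \<open>This is the tensor product of \<open>G\<close> with identities on \<open>a\<close>
  strands to its left and \<open>b\<close> strands to its right.\<close>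

lemma sandwich_mem:
  assumes "tmat N k l G \<in> C k l"
  shows "tmat N (a + k + b) (a + l + b) (\<lambda>xs ys. of_bool (take a xs = take a ys) *
    G (take l (drop a xs)) (take k (drop a ys)) * of_bool (drop (a + l) xs = drop (a + k) ys))
    \<in> C (a + k + b) (a + l + b)"
proof -
  have "kronecker (kronecker (tmat N a a (\<lambda>xs ys. of_bool (xs = ys))) (tmat N k l G)) (tmat N b b (\<lambda>xs ys. of_bool (xs = ys)))
      \<in> C (a + k + b) (a + l + b)"
    by (intro kronecker_mem id_mem assms)
  then show ?thesis
    by (simp add: tmat_kronecker take_drop add.commute min_def)
qed

text \<open>One half of Frobenius reciprocity: a strand is added on the right, and the cap joins it
  to the rightmost lower leg, which thereby becomes an upper leg.\<close>

lemma bend_mem: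
  assumes "tmat N k (Suc l) G \<in> C k (Suc l)"
  shows "tmat N (Suc k) l (\<lambda>xs ys. G (xs @ [last ys]) (butlast ys)) \<in> C (Suc k) l"
proof -
  let ?A = "tmat N (0 + k + 1) (0 + Suc l + 1) (\<lambda>xs ys. of_bool (take 0 xs = take 0 ys) *
    G (take (Suc l) (drop 0 xs)) (take k (drop 0 ys)) * of_bool (drop (0 + Suc l) xs = drop (0 + k) ys))"
  let ?B = "tmat N (l + 2 + 0) (l + 0 + 0) (\<lambda>xs ys. of_bool (take l xs = take l ys) *
    of_bool (take 2 (drop l ys) ! 0 = take 2 (drop l ys) ! 1) * of_bool (drop (l + 0) xs = drop (l + 2) ys))"
  have "?B * ?A \<in> C (Suc k) l"
    using mult_mem[of ?B "l + 2" l ?A "Suc k"] sandwich_mem[OF assms, of 0 1] sandwich_mem[OF cap_mem, of l 0]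
    by simp
  also have "?B * ?A = tmat N (Suc k) l (\<lambda>xs ys. G (xs @ [last ys]) (butlast ys))"
  proof -
    have "(\<Sum>w\<in>words N (l + 2). of_bool (take l xs = take l w) *
          of_bool (take 2 (drop l w) ! 0 = take 2 (drop l w) ! 1) * of_bool (drop (l + 0) xs = drop (l + 2) w) *
          (of_bool (take 0 w = take 0 ys) *
           G (take (Suc l) (drop 0 w)) (take k (drop 0 ys)) * of_bool (drop (0 + Suc l) w = drop (0 + k) ys))) =
        G (xs @ [last ys]) (butlast ys)"
      if xy: "xs \<in> words N l" "ys \<in> words N (Suc k)" for xs ys
    proof (subst sum_eq_single[of _ "xs @ [last ys, last ys]"])
      have len: "length xs = l" "length ys = Suc k" using xy by (auto simp: words_def)
      then obtain y0 y where ys: "ys = y0 @ [y]" "length y0 = k"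
        by (metis append_butlast_last_id length_butlast diff_Suc_1 length_0_conv nat.distinct(1))
      show "xs @ [last ys, last ys] \<in> words N (l + 2)" using xy ys by (auto simp: words_def)
      show "of_bool (take l xs = take l w) *
          of_bool (take 2 (drop l w) ! 0 = take 2 (drop l w) ! 1) * of_bool (drop (l + 0) xs = drop (l + 2) w) *
          (of_bool (take 0 w = take 0 ys) *
           G (take (Suc l) (drop 0 w)) (take k (drop 0 ys)) * of_bool (drop (0 + Suc l) w = drop (0 + k) ys)) = 0"
        if w: "w \<in> words N (l + 2)" "w \<noteq> xs @ [last ys, last ys]" for w
      proof -
        have "length (drop l w) = 2" "length (take l w) = l" using w(1) by (simp_all add: words_def)
        moreover from this(1) obtain p q where "drop l w = [p, q]"
          by (auto simp: numeral_2_eq_2 length_Suc_conv simp del: length_drop)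
        ultimately obtain w0 p q where "w = w0 @ [p, q]" "length w0 = l"
          by (metis append_take_drop_id)
        then show ?thesis using w(2) ys len by auto
      qed
      show "of_bool (take l xs = take l (xs @ [last ys, last ys])) *
          of_bool (take 2 (drop l (xs @ [last ys, last ys])) ! 0 = take 2 (drop l (xs @ [last ys, last ys])) ! 1) *
          of_bool (drop (l + 0) xs = drop (l + 2) (xs @ [last ys, last ys])) *
          (of_bool (take 0 (xs @ [last ys, last ys]) = take 0 ys) *
           G (take (Suc l) (drop 0 (xs @ [last ys, last ys]))) (take k (drop 0 ys)) *
           of_bool (drop (0 + Suc l) (xs @ [last ys, last ys]) = drop (0 + k) ys)) = G (xs @ [last ys]) (butlast ys)"
        using ys len by simp
    qed simp
    then show ?thesis
      using tmat_mult[of N "l + 2" l _ "Suc k"] by (simp add: tmat_eq_iff)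
  qed
  finally show ?thesis .
qed

text \<open>Bending the last two legs of the four-point crossing upwards reverses their order, so
  its two blocks join the lower points crosswise to the upper ones.\<close>

lemma swap_mem:
  assumes "pmat N [] [0, 1, 0, 1] \<in> C 0 4"
  shows "tmat N 2 2 (\<lambda>xs ys. of_bool (xs = rev ys)) \<in> C 2 2"
proof -
  have "tmat N 0 (Suc (Suc 2)) (\<lambda>xs ys. of_bool (fits [0, 1, 0, 1] (xs @ ys))) \<in> C 0 (Suc (Suc 2))"
    using assms by (simp add: pmat_def numeral_eq_Suc)
  from bend_mem[OF bend_mem[OF this]]
  have "tmat N 2 2 (\<lambda>xs ys. of_bool (fits [0, 1, 0, 1] (((xs @ [last ys]) @ [last (butlast ys)]) @ butlast (butlast ys)))) \<in> C 2 2"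
    by (simp add: numeral_2_eq_2)
  also have "tmat N 2 2 (\<lambda>xs ys. of_bool (fits [0, 1, 0, 1] (((xs @ [last ys]) @ [last (butlast ys)]) @ butlast (butlast ys)))) =
    tmat N 2 2 (\<lambda>xs ys. of_bool (xs = rev ys))"
  proof (rule tmat_cong)
    fix xs ys assume "xs \<in> words N 2" "ys \<in> words N 2"
    then obtain x x' y y' where "xs = [x, x']" "ys = [y, y']"
      by (auto simp: words_def numeral_2_eq_2 length_Suc_conv)
    then show "(of_bool (fits [0, 1, 0, 1] (((xs @ [last ys]) @ [last (butlast ys)]) @ butlast (butlast ys))) :: complex) =
        of_bool (xs = rev ys)"
      by (simp add: fits_crossing)
  qed
  finally show ?thesis .
qed

lemma swap_upper_mem:
  assumes swap: "tmat N 2 2 (\<lambda>xs ys. of_bool (xs = rev ys)) \<in> C 2 2"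
    and "pmat N (us @ p # q # vs) ls \<in> C (length (us @ p # q # vs)) (length ls)"
  shows "pmat N (us @ q # p # vs) ls \<in> C (length (us @ q # p # vs)) (length ls)"
proof -
  let ?a = "length us" and ?b = "length vs" and ?l = "length ls"
  let ?n = "?a + 2 + ?b"
  let ?S = "\<lambda>xs ys :: nat list. of_bool (take ?a xs = take ?a ys) *
    of_bool (take 2 (drop ?a xs) = rev (take 2 (drop ?a ys))) * of_bool (drop (?a + 2) xs = drop (?a + 2) ys) :: complex"
  let ?G = "\<lambda>xs ys. of_bool (fits (ls @ us @ p # q # vs) (xs @ ys)) :: complex"
  let ?H = "\<lambda>xs ys. of_bool (fits (ls @ us @ q # p # vs) (xs @ ys)) :: complex"
  have "tmat N ?n ?l ?G * tmat N ?n ?n ?S \<in> C ?n ?l"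
    using assms(2) sandwich_mem[OF swap, of ?a ?b] by (intro mult_mem) (simp_all add: pmat_def)
  also have "tmat N ?n ?l ?G * tmat N ?n ?n ?S = tmat N ?n ?l ?H"
    unfolding tmat_mult
  proof (rule tmat_cong)
    fix xs zs assume xs: "xs \<in> words N ?l" and zs: "zs \<in> words N ?n"
    have split: "\<exists>y0 y y' y1. w = y0 @ y # y' # y1 \<and> length y0 = ?a \<and> length y1 = ?b" if "w \<in> words N ?n" for w
    proof -
      have "length (drop ?a w) = Suc (Suc ?b)" using that by (simp add: words_def)
      then obtain y y' y1 where "drop ?a w = y # y' # y1" "length y1 = ?b"
        by (auto simp: length_Suc_conv simp del: length_drop)
      moreover have "w = take ?a w @ drop ?a w" "length (take ?a w) = ?a" using that by (simp_all add: words_def)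
      ultimately show ?thesis by metis
    qed
    obtain y0 y y' y1 where z: "zs = y0 @ y # y' # y1" "length y0 = ?a" "length y1 = ?b"
      using split[OF zs] by blast
    have "(\<Sum>ys\<in>words N ?n. ?G xs ys * ?S ys zs) = ?G xs (y0 @ y' # y # y1) * ?S (y0 @ y' # y # y1) zs"
    proof (rule sum_eq_single)
      show "y0 @ y' # y # y1 \<in> words N ?n" using zs z by (auto simp: words_def)
      fix w assume w: "w \<in> words N ?n" "w \<noteq> y0 @ y' # y # y1"
      obtain w0 v v' w1 where "w = w0 @ v # v' # w1" "length w0 = ?a" "length w1 = ?b"
        using split[OF w(1)] by blast
      then show "?G xs w * ?S w zs = 0" using w z by auto
    qed simp
    also have "\<dots> = ?G xs (y0 @ y' # y # y1)" using z by simp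
    also have "fits (ls @ us @ p # q # vs) (xs @ y0 @ y' # y # y1) =
        fits (ls @ us @ q # p # vs) (xs @ y0 @ y # y' # y1)"
    proof -
      have "set (zip (ls @ us @ p # q # vs) (xs @ y0 @ y' # y # y1)) =
          set (zip (ls @ us @ q # p # vs) (xs @ y0 @ y # y' # y1))"
        using xs z by (auto simp: words_def)
      then show ?thesis using xs z by (simp add: fits_zip words_def)
    qed
    finally show "(\<Sum>ys\<in>words N ?n. ?G xs ys * ?S ys zs) = ?H xs zs" using z by simp
  qed
  finally show ?thesis by (simp add: pmat_def)
qed

text \<open>With the rows exchanged, permutations of upper points become permutations of lower
  points.\<close>

lemma adjoint_pmat_mem:
  assumes "pmat N us ls \<in> C (length us) (length ls)"
  shows "pmat N ls us \<in> C (length ls) (length us)"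
proof -
  have "mat_adjoint (pmat N us ls) = pmat N ls us"
    unfolding pmat_def tmat_adjoint
  proof (rule tmat_cong)
    fix xs ys assume *: "xs \<in> words N (length us)" "ys \<in> words N (length ls)"
    then have "set (zip (ls @ us) (ys @ xs)) = set (zip (us @ ls) (xs @ ys))"
      by (auto simp: words_def)
    then show "cnj (of_bool (fits (ls @ us) (ys @ xs))) = of_bool (fits (us @ ls) (xs @ ys))"
      using * by (simp add: fits_zip words_def)
  qed
  then show ?thesis using adjoint_mem[OF assms] by simp
qed

text \<open>Sorted label lists give noncrossing partitions, and every partition arises from a sorted one by
  adjacent transpositions of the points, that is, by composition with copies of the swap.\<close>

lemma P_dual_le:
  assumes "pmat N [] [0, 1, 0, 1] \<in> C 0 4"
  shows "P_dual N \<le> C"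
proof -
  have upper: "pmat N vs ls \<in> C (length vs) (length ls)"
    if "mset us = mset vs" "pmat N us ls \<in> C (length us) (length ls)" for us vs ls
    using adjacent_swaps[where Q = "\<lambda>us. pmat N us ls \<in> C (length us) (length ls)"]
      swap_upper_mem[OF swap_mem[OF assms]] that by blast
  have "pmat N us ls \<in> C (length us) (length ls)" for us ls
  proof -
    have "pmat N (sort us) (sort ls) \<in> C (length (sort us)) (length (sort ls))"
      by (intro noncrossing_mem not_crosses_sorted) simp_all
    then have "pmat N us (sort ls) \<in> C (length us) (length (sort ls))"
      by (intro upper[of "sort us" us]) simp_all
    then have "pmat N (sort ls) us \<in> C (length (sort ls)) (length us)"
      by (rule adjoint_pmat_mem)
    then have "pmat N ls us \<in> C (length ls) (length us)"
      by (intro upper[of "sort ls" ls us]) simp_all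
    then show ?thesis by (rule adjoint_pmat_mem)
  qed
  then show ?thesis by (intro le_funI P_dual_span(3) subspace) auto
qed

section \<open>Rotating, deleting and merging points of tensors\<close>

definition tensor_mem :: "nat \<Rightarrow> (nat list \<Rightarrow> complex) \<Rightarrow> bool" where
  "tensor_mem k F \<longleftrightarrow> tmat N 0 k (\<lambda>xs _. F xs) \<in> C 0 k"

lemma tensor_mem_cong:
  "(\<And>xs. xs \<in> words N k \<Longrightarrow> F xs = G xs) \<Longrightarrow> tensor_mem k F \<longleftrightarrow> tensor_mem k G"
  unfolding tensor_mem_def by (simp cong: tmat_cong)

text \<open>The last leg is bent upwards, an identity strand is placed on the left, and the cup
  joins the two upper ends; the last leg reappears as the first.\<close>

lemma tensor_mem_rotate1:
  assumes "tensor_mem k F"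
  shows "tensor_mem k (\<lambda>xs. F (rotate1 xs))"
proof (cases k)
  case (Suc l)
  let ?G = "\<lambda>xs ys. of_bool (take 1 xs = take 1 ys) *
    F (take l (drop 1 xs) @ [last (take 1 (drop 1 ys))]) * of_bool (drop (1 + l) xs = drop (1 + 1) ys)"
  let ?A = "tmat N 2 (Suc l) ?G"
  let ?B = "tmat N 0 2 (\<lambda>xs _. of_bool (xs ! 0 = xs ! 1))"
  have "tmat N 0 (Suc l) (\<lambda>xs _. F xs) \<in> C 0 (Suc l)" using assms Suc by (simp add: tensor_mem_def)
  from sandwich_mem[OF bend_mem[OF this], of 1 0]
  have A: "?A \<in> C 2 (Suc l)" by (simp add: numeral_2_eq_2)
  have B: "?B \<in> C 0 2" using adjoint_mem[OF cap_mem] by (simp add: tmat_adjoint of_bool_def if_distrib[of cnj] cong: if_cong)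
  from mult_mem[OF A B] have "?A * ?B \<in> C 0 (Suc l)" .
  also have "?A * ?B = tmat N 0 (Suc l) (\<lambda>xs _. F (rotate1 xs))"
  proof -
    have "(\<Sum>w\<in>words N 2. ?G xs w * of_bool (w ! 0 = w ! 1)) = F (rotate1 xs)" if "xs \<in> words N (Suc l)" for xs
    proof -
      from that obtain x ys where xs: "xs = x # ys" "x < N" "length ys = l"
        by (auto simp: words_def length_Suc_conv)
      show ?thesis
        by (subst sum_eq_single[OF finite_words, of "[x, x]"])
          (use xs in \<open>auto simp: words_def length_Suc_conv numeral_2_eq_2\<close>)
    qed
    then show ?thesis unfolding tmat_mult by (rule tmat_cong)
  qed
  finally show ?thesis using Suc by (simp add: tensor_mem_def)
next
  case 0
  have "tmat N 0 0 (\<lambda>xs _. F xs) = tmat N 0 0 (\<lambda>xs _. F (rotate1 xs))" by (rule tmat_cong) simp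
  then show ?thesis using assms 0 by (simp add: tensor_mem_def)
qed

lemma tensor_mem_rotate: "tensor_mem k F \<Longrightarrow> tensor_mem k (\<lambda>xs. F (rotate j xs))"
proof (induction j)
  case (Suc j)
  then have "tensor_mem k (\<lambda>xs. F (rotate j (rotate1 xs)))" by (intro tensor_mem_rotate1) simp
  then show ?case by (simp add: rotate1_rotate_swap)
qed simp

text \<open>Composition with the partition map of a single upper point.\<close>

lemma tensor_mem_delete:
  assumes "tensor_mem (Suc k) F"
  shows "tensor_mem k (\<lambda>xs. \<Sum>a<N. F (a # xs))"
proof -
  let ?A = "tmat N (0 + 1 + k) (0 + 0 + k) (\<lambda>xs ys. of_bool (take 0 xs = take 0 ys) *
    of_bool (fits [0] (take 0 (drop 0 xs) @ take 1 (drop 0 ys))) * of_bool (drop (0 + 0) xs = drop (0 + 1) ys))"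
  have "pmat N [0] [] \<in> C 1 0" using noncrossing_mem[of "[0]" "[]"] by (simp add: crosses_def)
  then have "tmat N 1 0 (\<lambda>xs ys. of_bool (fits [0] (xs @ ys))) \<in> C 1 0" by (simp add: pmat_def)
  from sandwich_mem[OF this, of 0 k]
  have A: "?A \<in> C (Suc k) k" by simp
  have "?A * tmat N 0 (Suc k) (\<lambda>xs _. F xs) \<in> C 0 k"
    using mult_mem[OF A] assms by (simp add: tensor_mem_def)
  also have "?A * tmat N 0 (Suc k) (\<lambda>xs _. F xs) = tmat N 0 k (\<lambda>xs _. \<Sum>a<N. F (a # xs))"
  proof -
    have "(\<Sum>w\<in>words N (Suc k). of_bool (take 0 xs = take 0 w) *
      of_bool (fits [0] (take 0 (drop 0 xs) @ take 1 (drop 0 w))) * of_bool (drop (0 + 0) xs = drop (0 + 1) w) * F w)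
      = (\<Sum>a<N. F (a # xs))" if "xs \<in> words N k" for xs
    proof -
      have "(\<Sum>ys\<in>words N k. of_bool (xs = ys) * F (a # ys)) = F (a # xs)" for a
        using that by (subst sum_eq_single[of _ xs]) auto
      then show ?thesis by (simp add: sum_words_Suc fits_def)
    qed
    then show ?thesis using tmat_mult[of N "Suc k" k _ 0] by (simp add: tmat_eq_iff)
  qed
  finally show ?thesis by (simp add: tensor_mem_def)
qed

text \<open>Composition with the one-block map from two points to one.\<close>

lemma tensor_mem_merge:
  assumes "tensor_mem (Suc (Suc k)) F"
  shows "tensor_mem (Suc k) (\<lambda>xs. F (hd xs # xs))"
proof -
  let ?A = "tmat N (0 + 2 + k) (0 + 1 + k) (\<lambda>xs ys. of_bool (take 0 xs = take 0 ys) *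
    of_bool (fits [0, 0, 0] (take 1 (drop 0 xs) @ take 2 (drop 0 ys))) * of_bool (drop (0 + 1) xs = drop (0 + 2) ys))"
  have "pmat N [0, 0] [0] \<in> C 2 1"
    using noncrossing_mem[of "[0, 0]" "[0]"] by (simp add: crosses_def numeral_2_eq_2)
  then have "tmat N 2 1 (\<lambda>xs ys. of_bool (fits [0, 0, 0] (xs @ ys))) \<in> C 2 1"
    by (simp add: pmat_def numeral_2_eq_2)
  from sandwich_mem[OF this, of 0 k]
  have A: "?A \<in> C (Suc (Suc k)) (Suc k)" by simp
  have "?A * tmat N 0 (Suc (Suc k)) (\<lambda>xs _. F xs) \<in> C 0 (Suc k)"
    using mult_mem[OF A] assms by (simp add: tensor_mem_def)
  also have "?A * tmat N 0 (Suc (Suc k)) (\<lambda>xs _. F xs) = tmat N 0 (Suc k) (\<lambda>xs _. F (hd xs # xs))"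
  proof -
    have "(\<Sum>w\<in>words N (Suc (Suc k)). of_bool (take 0 xs = take 0 w) *
      of_bool (fits [0, 0, 0] (take 1 (drop 0 xs) @ take 2 (drop 0 w))) * of_bool (drop (0 + 1) xs = drop (0 + 2) w) * F w)
      = F (hd xs # xs)" if "xs \<in> words N (Suc k)" for xs
    proof -
      from that obtain x ys where xs: "xs = x # ys" "x < N" "length ys = k" "set ys \<subseteq> {..<N}"
        by (auto simp: words_def length_Suc_conv)
      show ?thesis
      proof (subst sum_eq_single[of _ "x # x # ys"], goal_cases)
        case (3 w)
        then obtain a b zs where "w = a # b # zs" by (auto simp: words_def length_Suc_conv)
        then show ?case using xs 3 by (auto simp: numeral_2_eq_2 fits_three)
      next
        case 1
        show ?case by (rule finite_words)
      qed (use xs in \<open>simp_all add: words_def numeral_2_eq_2 fits_three\<close>)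
    qed
    then show ?thesis using tmat_mult[of N "Suc (Suc k)" "Suc k" _ 0] by (simp add: tmat_eq_iff)
  qed
  finally show ?thesis by (simp add: tensor_mem_def)
qed

end

section \<open>Contractions of tensors\<close>

lemma fits_Cons:
  assumes "length rs = length xs"
  shows "fits (c # rs) (x # xs) \<longleftrightarrow>
    (\<forall>p\<in>set (zip rs xs). fst p = c \<longrightarrow> snd p = x) \<and> fits rs xs"
  using assms by (subst (1 2) fits_zip) auto

lemma fits_rotate:
  assumes "length rs = length xs"
  shows "fits (rotate j rs) (rotate j xs) \<longleftrightarrow> fits rs xs"
proof (induction j)
  case (Suc j)
  have "fits (rotate1 rs) (rotate1 xs) \<longleftrightarrow> fits rs xs" if "length rs = length xs" for rs xs
  proof -
    have "set (zip (rotate1 rs) (rotate1 xs)) = set (zip rs xs)"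
      using that by (cases rs; cases xs) auto
    then show ?thesis using that by (simp add: fits_zip)
  qed
  from this[of "rotate j rs" "rotate j xs"] show ?case using Suc assms by simp
qed simp

fun merge_head :: "nat list \<Rightarrow> nat list" where
  "merge_head (c # d # rs) = c # map (\<lambda>e. if e = d then c else e) rs"
| "merge_head rs = rs"

text \<open>Repeating \<open>x\<close> at the head prescribes it on the blocks of both
  \<open>c\<close> and \<open>d\<close>, exactly as one joint block would; relabelling
  \<open>d\<close> by \<open>c\<close> forms that block.\<close>

lemma fits_merge_head:
  assumes "length rs = length ys"
  shows "fits (c # d # rs) (x # x # ys) \<longleftrightarrow> fits (merge_head (c # d # rs)) (x # ys)"
proof -
  let ?Z = "set (zip rs ys)"
  have zip: "set (zip (map (\<lambda>e. if e = d then c else e) rs) ys) = (\<lambda>(e, y). (if e = d then c else e, y)) ` ?Z"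
    by (auto simp: zip_map1)
  have "fits (c # d # rs) (x # x # ys) \<longleftrightarrow>
      (\<forall>p\<in>?Z. (fst p = c \<or> fst p = d) \<longrightarrow> snd p = x) \<and>
      (\<forall>p\<in>?Z. \<forall>q\<in>?Z. fst p = fst q \<longrightarrow> snd p = snd q)"
    using assms by (auto simp: fits_Cons fits_zip[OF assms])
  also have "\<dots> \<longleftrightarrow> fits (merge_head (c # d # rs)) (x # ys)"
    using assms
    by (simp add: fits_Cons fits_zip zip split: prod.splits) (smt (verit) prod.collapse fst_conv snd_conv)
  finally show ?thesis .
qed

text \<open>If the block of the deleted point has another member, that member forces the index; a
  singleton leaves it free, with \<open>N\<close> choices.\<close>

lemma sum_compat_Cons:
  assumes xs: "xs \<in> words N k" and rs: "length rs = k"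
  shows "(\<Sum>a<N. of_bool (fits (c # rs) (a # xs))) =
    (if c \<in> set rs then 1 else of_nat N) * (of_bool (fits rs xs) :: complex)"
proof (cases "c \<in> set rs")
  case True
  then obtain m where m: "m < k" "rs ! m = c" using rs by (auto simp: in_set_conv_nth)
  have len: "length rs = length xs" and xm: "xs ! m < N"
    using xs rs m by (auto simp: words_def subset_iff)
  have "fits (c # rs) (a # xs) \<longleftrightarrow> fits rs xs \<and> a = xs ! m" for a
  proof -
    have mem: "(c, xs ! m) \<in> set (zip rs xs)" using m rs len by (force simp: set_zip)
    have "(\<forall>p\<in>set (zip rs xs). fst p = c \<longrightarrow> snd p = a) \<longleftrightarrow> a = xs ! m" if "fits rs xs"
      using that mem unfolding fits_zip[OF len] by fastforce
    then show ?thesis using fits_Cons[OF len] by blast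
  qed
  then show ?thesis using True xm by (simp add: of_bool_conj)
next
  case False
  have len: "length rs = length xs" using xs rs by (simp add: words_def)
  have "fits (c # rs) (a # xs) \<longleftrightarrow> fits rs xs" for a
    using False by (auto simp: fits_Cons[OF len] dest!: set_zip_leftD)
  then show ?thesis using False by simp
qed

text \<open>After a rotation by \<open>j\<close>, the first point is deleted (\<open>b = False\<close>, summing over its index) or
  merged with the second one (\<open>b = True\<close>). The deletion of a singleton block produces the factor \<open>N\<close>.\<close>

definition contract :: "nat \<Rightarrow> bool \<Rightarrow> nat list \<Rightarrow> nat list" where
  "contract j b r = normal_form (if b then merge_head (rotate j r) else tl (rotate j r))"

definition weight :: "nat \<Rightarrow> nat \<Rightarrow> bool \<Rightarrow> nat list \<Rightarrow> nat" where
  "weight N j b r = (if b \<or> hd (rotate j r) \<in> set (tl (rotate j r)) then 1 else N)"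

lemma length_merge_head [simp]: "length (merge_head rs) = (if length rs \<le> 1 then length rs else length rs - 1)"
  by (cases rs rule: merge_head.cases) auto

lemma length_contract [simp]: "2 \<le> length r \<Longrightarrow> length (contract j b r) = length r - 1"
  by (simp add: contract_def)

context intermediate_dual
begin

lemma tensor_mem_sum:
  "finite I \<Longrightarrow> (\<And>i. i \<in> I \<Longrightarrow> tensor_mem k (F i)) \<Longrightarrow> tensor_mem k (\<lambda>xs. \<Sum>i\<in>I. c i * F i xs)"
  unfolding tensor_mem_def by (rule subspace_tmat_sum[OF subspace])

text \<open>Contraction acts termwise and sends a partition map to a weighted partition map, so the
  coefficients of the contracted tensor are explicit.\<close>

lemma tensor_mem_contract:
  assumes F: "tensor_mem (Suc (Suc k)) (\<lambda>xs. \<Sum>i\<in>I. c i * of_bool (fits (r i) xs))"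
    and len: "\<And>i. i \<in> I \<Longrightarrow> length (r i) = Suc (Suc k)"
  shows "tensor_mem (Suc k) (\<lambda>xs. \<Sum>i\<in>I. c i * of_nat (weight N j b (r i)) *
    of_bool (fits (contract j b (r i)) xs))"
proof -
  let ?n = "Suc (Suc k)"
  have rot: "rotate j (rotate (?n - j mod ?n) xs) = xs" if "length xs = ?n" for xs :: "nat list"
  proof -
    have "(j + (?n - j mod ?n)) mod ?n = (j mod ?n + (?n - j mod ?n)) mod ?n"
      by (simp only: mod_add_left_eq)
    also have "\<dots> = 0" by simp
    finally show ?thesis using that by (metis rotate_rotate rotate_conv_mod rotate0 id_apply)
  qed
  \<comment> \<open>Rotating the indices by the complementary amount has the same effect as rotating
    the labels by \<open>j\<close>.\<close>
  have "tensor_mem ?n (\<lambda>xs. \<Sum>i\<in>I. c i * of_bool (fits (r i) (rotate (?n - j mod ?n) xs)))"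
    by (rule tensor_mem_rotate[OF F])
  also have "?this \<longleftrightarrow> tensor_mem ?n (\<lambda>xs. \<Sum>i\<in>I. c i * of_bool (fits (rotate j (r i)) xs))"
  proof (rule tensor_mem_cong, rule sum.cong[OF refl])
    fix xs i assume "xs \<in> words N ?n" "i \<in> I"
    then show "c i * of_bool (fits (r i) (rotate (?n - j mod ?n) xs)) = c i * of_bool (fits (rotate j (r i)) xs)"
      using fits_rotate[of "r i" "rotate (?n - j mod ?n) xs" j] rot[of xs] len[of i]
      by (simp add: length_words)
  qed
  finally have R: "tensor_mem ?n (\<lambda>xs. \<Sum>i\<in>I. c i * of_bool (fits (rotate j (r i)) xs))" .
  show ?thesis
  proof (cases b)
    case True
    have "tensor_mem (Suc k) (\<lambda>xs. \<Sum>i\<in>I. c i * of_bool (fits (rotate j (r i)) (hd xs # xs)))"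
      by (rule tensor_mem_merge[OF R])
    also have "?this \<longleftrightarrow> ?thesis"
    proof (rule tensor_mem_cong, rule sum.cong[OF refl])
      fix xs i assume *: "xs \<in> words N (Suc k)" "i \<in> I"
      then obtain x ys where xs: "xs = x # ys" "length ys = k" by (auto simp: words_def length_Suc_conv)
      have "length (rotate j (r i)) = Suc (Suc k)" using len * by simp
      then obtain p q rs where rs: "rotate j (r i) = p # q # rs" "length rs = k"
        by (auto simp: length_Suc_conv simp del: length_rotate)
      show "c i * of_bool (fits (rotate j (r i)) (hd xs # xs)) =
          c i * of_nat (weight N j b (r i)) * of_bool (fits (contract j b (r i)) xs)"
        using True xs rs fits_merge_head[of rs ys p q x] by (simp add: contract_def weight_def)
    qed
    finally show ?thesis .
  next
    case False
    have "tensor_mem (Suc k) (\<lambda>xs. \<Sum>a<N. \<Sum>i\<in>I. c i * of_bool (fits (rotate j (r i)) (a # xs)))"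
      by (rule tensor_mem_delete[OF R])
    also have "?this \<longleftrightarrow> ?thesis"
    proof (rule tensor_mem_cong)
      fix xs assume xs: "xs \<in> words N (Suc k)"
      have "(\<Sum>a<N. c i * of_bool (fits (rotate j (r i)) (a # xs))) =
          c i * of_nat (weight N j b (r i)) * of_bool (fits (contract j b (r i)) xs)" if "i \<in> I" for i
      proof -
        have "length (rotate j (r i)) = Suc (Suc k)" using len that by simp
        then obtain p rs where "rotate j (r i) = p # rs" "length rs = Suc k"
          by (auto simp: length_Suc_conv simp del: length_rotate)
        then show ?thesis
          using False sum_compat_Cons[OF xs, of rs p]
          by (simp add: contract_def weight_def flip: sum_distrib_left)
      qed
      then show "(\<Sum>a<N. \<Sum>i\<in>I. c i * of_bool (fits (rotate j (r i)) (a # xs))) =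
          (\<Sum>i\<in>I. c i * of_nat (weight N j b (r i)) * of_bool (fits (contract j b (r i)) xs))"
        by (subst sum.swap) (rule sum.cong[OF refl])
    qed
    finally show ?thesis .
  qed
qed

lemma tensor_mem_fits: "tensor_mem (length r) (\<lambda>xs. of_bool (fits r xs)) \<longleftrightarrow> pmat N [] r \<in> C 0 (length r)"
proof -
  have "pmat N [] r = tmat N 0 (length r) (\<lambda>xs _. of_bool (fits r xs))"
    unfolding pmat_def by (auto intro!: tmat_cong)
  then show ?thesis by (simp add: tensor_mem_def)
qed

text \<open>The noncrossing terms lie in \<open>C\<close> and can be subtracted. What remains is a
  multiple of the four-point crossing, and a nonzero factor could be divided out.\<close>

lemma crossing_coeff_four:
  assumes nocross: "pmat N [] [0, 1, 0, 1] \<notin> C 0 4"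
    and "finite I" and len: "\<And>i. i \<in> I \<Longrightarrow> length (r i) = 4"
    and F: "tensor_mem 4 (\<lambda>xs. \<Sum>i\<in>I. c i * of_bool (fits (r i) xs))"
  shows "(\<Sum>i\<in>I. c i * of_bool (crosses (r i))) = 0"
proof (rule ccontr)
  let ?X = "\<lambda>xs. of_bool (fits [0, 1, 0, 1] xs) :: complex"
  let ?F = "\<lambda>xs. \<Sum>i\<in>I. c i * of_bool (fits (r i) xs)"
  define s where "s = (\<Sum>i\<in>I. c i * of_bool (crosses (r i)))"
  assume "(\<Sum>i\<in>I. c i * of_bool (crosses (r i))) \<noteq> 0"
  then have s: "s \<noteq> 0" by (simp add: s_def)
  let ?J = "{i \<in> I. \<not> crosses (r i)}"
  let ?G = "\<lambda>xs. \<Sum>i\<in>?J. c i * of_bool (fits (r i) xs)"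
  have G: "tensor_mem 4 ?G"
  proof (rule tensor_mem_sum)
    fix i assume i: "i \<in> ?J"
    \<comment> \<open>The circular order runs through lower points from right to left, so the
      reversed labels have to be noncrossing.\<close>
    have "\<not> crosses (rev (r i))"
    proof
      assume "crosses (rev (r i))"
      then obtain a b m n where "a < b" "b < m" "m < n" "n < length (r i)"
        "rev (r i) ! a = rev (r i) ! m" "rev (r i) ! b = rev (r i) ! n" "rev (r i) ! a \<noteq> rev (r i) ! b"
        unfolding crosses_def by auto
      then have "crosses (r i)"
        by (intro crossesI[of "length (r i) - Suc n" "length (r i) - Suc m" "length (r i) - Suc b" "length (r i) - Suc a"])
          (auto simp: rev_nth)
      then show False using i by simp
    qed
    then show "tensor_mem 4 (\<lambda>xs. of_bool (fits (r i) xs))"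
      using noncrossing_mem[of "[]" "r i"] i len tensor_mem_fits[of "r i"] by simp
  qed (use \<open>finite I\<close> in simp)
  \<comment> \<open>The sum over the two truth values writes \<open>(?F xs - ?G xs) / s\<close> as a
    linear combination.\<close>
  have "tensor_mem 4 (\<lambda>xs. \<Sum>t\<in>UNIV. (if t then 1 / s else - 1 / s) * (if t then ?F xs else ?G xs))"
  proof (rule tensor_mem_sum)
    show "tensor_mem 4 (\<lambda>xs. if t then ?F xs else ?G xs)" for t
      using F G by (cases t) simp_all
  qed simp
  also have "?this \<longleftrightarrow> tensor_mem 4 ?X"
  proof (rule tensor_mem_cong)
    fix xs assume xs: "xs \<in> words N 4"
    have "c i * of_bool (fits (r i) xs) = c i * of_bool (crosses (r i)) * ?X xs +
        (if crosses (r i) then 0 else c i * of_bool (fits (r i) xs))" if i: "i \<in> I" for i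
    proof (cases "crosses (r i)")
      case True
      then obtain p q where "r i = [p, q, p, q]" "p \<noteq> q"
      proof -
        from True obtain a b m n where *: "a < b" "b < m" "m < n" "n < length (r i)"
          "r i ! a = r i ! m" "r i ! b = r i ! n" "r i ! a \<noteq> r i ! b"
          unfolding crosses_def by blast
        have len4: "length (r i) = 4" using len i by simp
        with *(1-4) have "a = 0 \<and> b = 1 \<and> m = 2 \<and> n = 3" by linarith
        moreover obtain x y z w where "r i = [x, y, z, w]"
          using len4 by (auto simp: numeral_eq_Suc length_Suc_conv)
        ultimately show ?thesis using that[of x y] *(5-7) by (simp add: numeral_eq_Suc)
      qed
      moreover obtain x y z w where "xs = [x, y, z, w]"
        using xs by (auto simp: words_def numeral_eq_Suc length_Suc_conv)
      ultimately show ?thesis using True fits_crossing[of p q x y z w] fits_crossing[of 0 1 x y z w] by simp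
    qed simp
    then have "?F xs = (\<Sum>i\<in>I. c i * of_bool (crosses (r i)) * ?X xs) +
        (\<Sum>i\<in>I. if crosses (r i) then 0 else c i * of_bool (fits (r i) xs))"
      by (simp flip: sum.distrib)
    also have "(\<Sum>i\<in>I. if crosses (r i) then 0 else c i * of_bool (fits (r i) xs)) = ?G xs"
      using \<open>finite I\<close> by (subst sum.inter_filter) (auto intro: sum.cong)
    finally have "?F xs = s * ?X xs + ?G xs" by (simp add: s_def sum_distrib_right)
    then show "(\<Sum>t\<in>UNIV. (if t then 1 / s else - 1 / s) * (if t then ?F xs else ?G xs)) = ?X xs"
      using s by (simp add: UNIV_bool field_simps)
  qed
  finally show False
    using nocross tensor_mem_fits[of "[0, 1, 0, 1]"] by (simp add: numeral_eq_Suc)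
qed

end

section \<open>Enumeration of crossing partitions\<close>

lemma crosses_code [code]:
  "crosses w \<longleftrightarrow> (\<exists>m\<in>set [0..<length w]. \<exists>i\<in>set [0..<m]. w ! i = w ! m \<and>
     (\<exists>j\<in>set [Suc i..<m]. w ! j \<noteq> w ! i \<and> w ! j \<in> set (drop (Suc m) w)))"
proof
  assume "crosses w"
  then obtain i j m n where *: "i < j" "j < m" "m < n" "n < length w"
    "w ! i = w ! m" "w ! j = w ! n" "w ! i \<noteq> w ! j"
    unfolding crosses_def by blast
  then have "w ! j \<in> set (drop (Suc m) w)"
    by (auto simp: in_set_conv_nth intro!: exI[of _ "n - Suc m"])
  then show "\<exists>m\<in>set [0..<length w]. \<exists>i\<in>set [0..<m]. w ! i = w ! m \<and>
     (\<exists>j\<in>set [Suc i..<m]. w ! j \<noteq> w ! i \<and> w ! j \<in> set (drop (Suc m) w))"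
    using * by (intro bexI[of _ m] bexI[of _ i] conjI bexI[of _ j]) auto
next
  assume "\<exists>m\<in>set [0..<length w]. \<exists>i\<in>set [0..<m]. w ! i = w ! m \<and>
     (\<exists>j\<in>set [Suc i..<m]. w ! j \<noteq> w ! i \<and> w ! j \<in> set (drop (Suc m) w))"
  then obtain i j m where *: "i < j" "j < m" "m < length w" "w ! i = w ! m" "w ! j \<noteq> w ! i"
    and "w ! j \<in> set (drop (Suc m) w)"
    by (auto simp: Suc_le_eq)
  then obtain q where "w ! (Suc m + q) = w ! j" "q < length w - Suc m"
    by (auto simp: in_set_conv_nth)
  then show "crosses w" using * by (intro crossesI[of i j m "Suc m + q"]) auto
qed

text \<open>The last label of a normal form of length \<open>Suc n\<close> is either an earlier
  label or its own position \<open>n\<close>.\<close>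

fun normal_forms :: "nat \<Rightarrow> nat list list" where
  "normal_forms 0 = [[]]"
| "normal_forms (Suc n) = concat (map (\<lambda>r. map (\<lambda>c. r @ [c]) (remdups r @ [n])) (normal_forms n))"

lemma first_index_append: "first_index (w @ v) x = (if x \<in> set w then first_index w x else length w + first_index v x)"
  by (induction w) (auto simp: first_index_def)

lemma normal_forms_complete: "normal_words n \<subseteq> set (normal_forms n)"
proof (induction n)
  case 0
  then show ?case by (auto simp: normal_words_def normal_form_def)
next
  case (Suc n)
  show ?case
  proof
    fix v assume "v \<in> normal_words (Suc n)"
    then obtain u where u: "length u = Suc n" "v = normal_form u" by (auto simp: normal_words_def)
    define w c where "w = butlast u" and "c = last u"
    have w: "u = w @ [c]" "length w = n"
      using u unfolding w_def c_def by (metis append_butlast_last_id list.size(3) nat.distinct(1), simp)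
    have v: "v = normal_form w @ [if c \<in> set w then first_index w c else n]"
      using u w by (auto simp: normal_form_def first_index_append)
    have "normal_form w \<in> set (normal_forms n)" using Suc w by auto
    moreover have "(if c \<in> set w then first_index w c else n) \<in> set (remdups (normal_form w) @ [n])"
      by (auto simp: normal_form_def)
    ultimately show "v \<in> set (normal_forms (Suc n))" unfolding v by auto
  qed
qed

text \<open>Bell numbers minus Catalan numbers: 52 - 42 = 10 forms on five points and 203 - 132 = 71
  on six.\<close>

definition crossing_forms :: "nat \<Rightarrow> nat list list" where
  "crossing_forms n = filter crosses (normal_forms n)"

lemma normal_form_crossing: "length r = n \<Longrightarrow> crosses r \<Longrightarrow> normal_form r \<in> set (crossing_forms n)"
  using normal_forms_complete[of n] by (auto simp: crossing_forms_def)

lemma crossing_forms_5: "crossing_forms 5 =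
  [[0, 0, 2, 0, 2], [0, 1, 0, 1, 0], [0, 1, 0, 1, 1], [0, 1, 0, 1, 4], [0, 1, 0, 0, 1],
   [0, 1, 0, 3, 1], [0, 1, 1, 0, 1], [0, 1, 2, 0, 1], [0, 1, 2, 0, 2], [0, 1, 2, 1, 2]]"
  by code_simp

section \<open>Equations for the crossing coefficients\<close>

definition group_rows :: "(nat list \<times> nat \<times> nat list) list \<Rightarrow> nat list list \<Rightarrow> (nat \<times> nat list) list list" where
  "group_rows T targets = map (\<lambda>s. map snd (filter (\<lambda>p. fst p = s) T)) targets"

definition contraction_rows :: "nat list list \<Rightarrow> nat list list \<Rightarrow> nat \<Rightarrow> bool \<Rightarrow> (nat \<times> nat list) list list" where
  "contraction_rows rs ss j b = group_rows (map (\<lambda>r. (contract j b r, weight 6 j b r, r)) rs) ss"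

text \<open>With ten targets, rotation \<open>j\<close> and target number \<open>i\<close> have
  index \<open>20 * j + i\<close> for deletion and \<open>20 * j + 10 + i\<close> for merging. The
  entries of \<open>solving_order\<close> are such indices.\<close>

definition all_rows :: "nat list list \<Rightarrow> nat list list \<Rightarrow> (nat \<times> nat list) list list" where
  "all_rows rs ss = concat (map (\<lambda>j. contraction_rows rs ss j False @ contraction_rows rs ss j True) [0..<6])"

text \<open>The factor with which the coefficient of \<open>r\<close> enters the crossing
  coefficient of the contracted four-point tensor.\<close>

definition four_coeff :: "nat \<Rightarrow> bool \<Rightarrow> nat list \<Rightarrow> nat" where
  "four_coeff j b r = weight 6 j b r * (if crosses (contract j b r) then 1 else 0)"

lemma four_coeff_table:
  "map (\<lambda>j. map (four_coeff j False) (crossing_forms 5)) [0..<5] =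
    [[1, 1, 0, 0, 0, 0, 0, 0, 0, 6], [1, 0, 0, 0, 0, 0, 1, 0, 6, 0], [0, 0, 0, 0, 1, 0, 1, 6, 0, 0],
     [0, 0, 1, 0, 1, 6, 0, 0, 0, 0], [0, 1, 1, 6, 0, 0, 0, 0, 0, 0]]"
  "map (\<lambda>j. map (four_coeff j True) (crossing_forms 5)) [0..<5] =
    [[1, 0, 0, 0, 0, 0, 0, 0, 1, 1], [0, 0, 0, 0, 0, 0, 1, 1, 1, 0], [0, 0, 0, 0, 1, 1, 0, 1, 0, 0],
     [0, 0, 1, 1, 0, 1, 0, 0, 0, 0], [0, 1, 0, 1, 0, 0, 0, 0, 0, 1]]"
  by code_simp+

text \<open>Contraction creates no crossings, so the noncrossing partitions of five points drop out
  of the equations for the crossing ones; this is checked case by case.\<close>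

lemma four_coeff_noncrossing:
  "list_all (\<lambda>r. crosses r \<or> list_all (\<lambda>j. four_coeff j False r = 0 \<and> four_coeff j True r = 0) [0..<5])
     (normal_forms 5)"
  by code_simp

lemma length_crossing_forms: "r \<in> set (crossing_forms n) \<Longrightarrow> length r = n"
proof -
  have "r \<in> set (normal_forms n) \<Longrightarrow> length r = n" for r
    by (induction n arbitrary: r) auto
  then show "r \<in> set (crossing_forms n) \<Longrightarrow> length r = n" by (auto simp: crossing_forms_def)
qed

lemma distinct_crossing_forms_5: "distinct (crossing_forms 5)"
  by (simp add: crossing_forms_5)

lemma distinct_crossing_forms_6: "distinct (crossing_forms 6)"
  by code_simp

text \<open>Eliminating the \<open>e\<close>'s makes \<open>4 * u\<close> at each vertex of a cycle of length five equal to the sum of \<open>u\<close> over its two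
  neighbours, which leaves only \<open>0\<close> by the maximum principle.\<close>

lemma five_cycle_trivial:
  fixes u0 u1 u2 u3 u4 e0 e1 e2 e3 e4 :: real
  assumes "u0 + u1 + 6 * e0 = 0" "u1 + u2 + 6 * e1 = 0" "u2 + u3 + 6 * e2 = 0" "u3 + u4 + 6 * e3 = 0"
    "u4 + u0 + 6 * e4 = 0" "u0 + e4 + e0 = 0" "u1 + e0 + e1 = 0" "u2 + e1 + e2 = 0" "u3 + e2 + e3 = 0"
    "u4 + e3 + e4 = 0"
  shows "u0 = 0 \<and> u1 = 0 \<and> u2 = 0 \<and> u3 = 0 \<and> u4 = 0 \<and> e0 = 0 \<and> e1 = 0 \<and> e2 = 0 \<and> e3 = 0 \<and> e4 = 0"
  using assms by (intro conjI; linarith)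

text \<open>The tables turn the ten contractions into the cyclic system of
  \<open>five_cycle_trivial\<close>.\<close>

lemma five_trivial:
  fixes \<beta> :: "nat list \<Rightarrow> real"
  assumes E: "\<And>j t. j < 5 \<Longrightarrow> (\<Sum>s\<in>set (crossing_forms 5). \<beta> s * real (four_coeff j t s)) = 0"
    and s: "s \<in> set (crossing_forms 5)"
  shows "\<beta> s = 0"
proof -
  have row: "(\<Sum>(s, m)\<leftarrow>zip (crossing_forms 5) ms. \<beta> s * real m) = 0"
    if j: "j < 5" and ms: "map (four_coeff j t) (crossing_forms 5) = ms" for j t ms
  proof -
    have "(\<Sum>(s, m)\<leftarrow>zip ss (map f ss). \<beta> s * real m) = (\<Sum>s\<leftarrow>ss. \<beta> s * real (f s))" for ss and f :: "nat list \<Rightarrow> nat"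
      by (induction ss) auto
    then show ?thesis
      using E[OF j, of t] ms distinct_crossing_forms_5 by (auto simp: sum_list_distinct_conv_sum_set)
  qed
  have T: "map (four_coeff j False) (crossing_forms 5) = map (\<lambda>j. map (four_coeff j False) (crossing_forms 5)) [0..<5] ! j"
    "map (four_coeff j True) (crossing_forms 5) = map (\<lambda>j. map (four_coeff j True) (crossing_forms 5)) [0..<5] ! j"
    if "j < 5" for j
    using that by simp_all
  note R = row[OF _ T(1), unfolded four_coeff_table] row[OF _ T(2), unfolded four_coeff_table]
  \<comment> \<open>Points are counted from 0 modulo five. In u_j the neighbours j - 1 and j share a
    block; in e_j the point j is a singleton. Deleting j makes a crossing out of u_j, u_(j+1) and,
    with weight 6, e_j; merging j and j + 1 makes one out of u_(j+1), e_j and e_(j+1).\<close>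
  let ?u0 = "\<beta> [0, 1, 0, 1, 0]" and ?u1 = "\<beta> [0, 0, 2, 0, 2]" and ?u2 = "\<beta> [0, 1, 1, 0, 1]"
    and ?u3 = "\<beta> [0, 1, 0, 0, 1]" and ?u4 = "\<beta> [0, 1, 0, 1, 1]"
  let ?e0 = "\<beta> [0, 1, 2, 1, 2]" and ?e1 = "\<beta> [0, 1, 2, 0, 2]" and ?e2 = "\<beta> [0, 1, 2, 0, 1]"
    and ?e3 = "\<beta> [0, 1, 0, 3, 1]" and ?e4 = "\<beta> [0, 1, 0, 1, 4]"
  have "?u0 + ?u1 + 6 * ?e0 = 0" "?u1 + ?u2 + 6 * ?e1 = 0" "?u2 + ?u3 + 6 * ?e2 = 0"
    "?u3 + ?u4 + 6 * ?e3 = 0" "?u4 + ?u0 + 6 * ?e4 = 0"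
    using R(1)[of 0] R(1)[of 1] R(1)[of 2] R(1)[of 3] R(1)[of 4]
    by (simp_all add: crossing_forms_5 algebra_simps del: One_nat_def)
  moreover have "?u0 + ?e4 + ?e0 = 0" "?u1 + ?e0 + ?e1 = 0" "?u2 + ?e1 + ?e2 = 0" "?u3 + ?e2 + ?e3 = 0"
    "?u4 + ?e3 + ?e4 = 0"
    using R(2)[of 0] R(2)[of 1] R(2)[of 2] R(2)[of 3] R(2)[of 4]
    by (simp_all add: crossing_forms_5 algebra_simps del: One_nat_def)
  ultimately have "?u0 = 0 \<and> ?u1 = 0 \<and> ?u2 = 0 \<and> ?u3 = 0 \<and> ?u4 = 0 \<and>
      ?e0 = 0 \<and> ?e1 = 0 \<and> ?e2 = 0 \<and> ?e3 = 0 \<and> ?e4 = 0"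
    by (rule five_cycle_trivial)
  then show ?thesis using s by (auto simp: crossing_forms_5)
qed

text \<open>Contraction from six points may produce repeated kernels and noncrossing terms. The
  coefficients are therefore collected by kernel before the ten equations are applied.\<close>

lemma (in intermediate_dual) crossing_coeff_five:
  assumes N: "N = 6" and nocross: "pmat N [] [0, 1, 0, 1] \<notin> C 0 4"
    and fin: "finite I" and len: "\<And>i. i \<in> I \<Longrightarrow> length (r i) = 5"
    and F: "tensor_mem 5 (\<lambda>xs. \<Sum>i\<in>I. c i * of_bool (fits (r i) xs))"
    and s: "s \<in> set (crossing_forms 5)"
  shows "(\<Sum>i\<in>I. c i * of_bool (normal_form (r i) = s)) = 0"
proof -
  define \<rho> where "\<rho> i = normal_form (r i)" for i
  define \<beta> where "\<beta> s = (\<Sum>i\<in>I. c i * of_bool (\<rho> i = s))" for s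
  have len\<rho>: "length (\<rho> i) = 5" if "i \<in> I" for i using len that by (simp add: \<rho>_def)
  have E: "(\<Sum>s\<in>set (crossing_forms 5). \<beta> s * of_nat (four_coeff j t s)) = 0" if j: "j < 5" for j t
  proof -
    have "tensor_mem (Suc (Suc 3)) (\<lambda>xs. \<Sum>i\<in>I. c i * of_bool (fits (\<rho> i) xs))"
      using F by (simp add: \<rho>_def)
    then have "tensor_mem (Suc 3) (\<lambda>xs. \<Sum>i\<in>I. c i * of_nat (weight N j t (\<rho> i)) * of_bool (fits (contract j t (\<rho> i)) xs))"
      by (rule tensor_mem_contract) (simp add: len\<rho>)
    then have "(\<Sum>i\<in>I. c i * of_nat (weight N j t (\<rho> i)) * of_bool (crosses (contract j t (\<rho> i)))) = 0"
      using fin len\<rho> by (intro crossing_coeff_four[OF nocross]) auto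
    also have "(\<Sum>i\<in>I. c i * of_nat (weight N j t (\<rho> i)) * of_bool (crosses (contract j t (\<rho> i)))) =
        (\<Sum>i\<in>I. \<Sum>s\<in>set (crossing_forms 5). c i * of_bool (\<rho> i = s) * of_nat (four_coeff j t s))"
    proof (rule sum.cong[OF refl])
      fix i assume i: "i \<in> I"
      have "\<rho> i \<in> set (normal_forms 5)"
        using normal_forms_complete[of 5] len i by (auto simp: \<rho>_def)
      then have "\<rho> i \<in> set (crossing_forms 5) \<or> four_coeff j t (\<rho> i) = 0"
        using four_coeff_noncrossing j by (cases t) (auto simp: list_all_iff crossing_forms_def)
      moreover have "c i * of_nat (weight N j t (\<rho> i)) * of_bool (crosses (contract j t (\<rho> i))) =
          c i * of_nat (four_coeff j t (\<rho> i))"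
        by (simp add: four_coeff_def N)
      moreover have "(\<Sum>s\<in>set (crossing_forms 5). c i * of_bool (\<rho> i = s) * of_nat (four_coeff j t s)) =
          (if \<rho> i \<in> set (crossing_forms 5) then c i * of_nat (four_coeff j t (\<rho> i)) else 0)"
      proof -
        have "(\<Sum>s\<in>set (crossing_forms 5). c i * of_bool (\<rho> i = s) * of_nat (four_coeff j t s)) =
            (\<Sum>s\<in>set (crossing_forms 5). if \<rho> i = s then c i * of_nat (four_coeff j t s) else 0)"
          by (intro sum.cong) simp_all
        also have "\<dots> = (if \<rho> i \<in> set (crossing_forms 5) then c i * of_nat (four_coeff j t (\<rho> i)) else 0)"
          by (rule sum.delta'[OF finite_set])
        finally show ?thesis .
      qed
      ultimately show "c i * of_nat (weight N j t (\<rho> i)) * of_bool (crosses (contract j t (\<rho> i))) =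
          (\<Sum>s\<in>set (crossing_forms 5). c i * of_bool (\<rho> i = s) * of_nat (four_coeff j t s))"
        by (metis mult_zero_right of_nat_0)
    qed
    also have "\<dots> = (\<Sum>s\<in>set (crossing_forms 5). \<beta> s * of_nat (four_coeff j t s))"
      unfolding \<beta>_def sum_distrib_right by (rule sum.swap)
    finally show ?thesis .
  qed
  have re: "(\<Sum>s\<in>S. Re (f s) * real (m s)) = Re (\<Sum>s\<in>S. f s * of_nat (m s))"
    and im: "(\<Sum>s\<in>S. Im (f s) * real (m s)) = Im (\<Sum>s\<in>S. f s * of_nat (m s))"
    for f :: "nat list \<Rightarrow> complex" and m S
    by simp_all
  have "Re (\<beta> s) = 0"
    by (rule five_trivial[OF _ s, of "\<lambda>s. Re (\<beta> s)"]) (simp only: re E zero_complex.sel)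
  moreover have "Im (\<beta> s) = 0"
    by (rule five_trivial[OF _ s, of "\<lambda>s. Im (\<beta> s)"]) (simp only: im E zero_complex.sel)
  ultimately show ?thesis by (simp add: complex_eq_iff \<beta>_def \<rho>_def)
qed

text \<open>Every crossing kernel on five points must receive total coefficient zero; sorting the
  contracted terms by kernel turns this into the rows.\<close>

lemma (in intermediate_dual) contraction_equation:
  assumes N: "N = 6" and nocross: "pmat N [] [0, 1, 0, 1] \<notin> C 0 4"
    and F: "tensor_mem 6 (\<lambda>xs. \<Sum>r\<in>set (crossing_forms 6). a r * of_bool (fits r xs))"
    and eqn: "eqn \<in> set (all_rows (crossing_forms 6) (crossing_forms 5))"
  shows "(\<Sum>(w, r)\<leftarrow>eqn. of_nat w * a r) = 0"
proof -
  let ?R = "crossing_forms 6"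
  have len: "length r = Suc (Suc 4)" if "r \<in> set ?R" for r
    using length_crossing_forms[OF that] by simp
  obtain j b s where s: "s \<in> set (crossing_forms 5)" and
    eqn': "eqn = map snd (filter (\<lambda>p. fst p = s) (map (\<lambda>r. (contract j b r, weight 6 j b r, r)) ?R))"
    using eqn by (auto simp: all_rows_def contraction_rows_def group_rows_def)
  have "tensor_mem (Suc (Suc 4)) (\<lambda>xs. \<Sum>r\<in>set ?R. a r * of_bool (fits r xs))"
    using F by simp
  then have "tensor_mem (Suc 4) (\<lambda>xs. \<Sum>r\<in>set ?R. a r * of_nat (weight N j b r) * of_bool (fits (contract j b r) xs))"
    by (rule tensor_mem_contract) (rule len)
  then have "(\<Sum>r\<in>set ?R. a r * of_nat (weight N j b r) * of_bool (normal_form (contract j b r) = s)) = 0"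
    using len by (intro crossing_coeff_five[OF N nocross _ _ _ s]) auto
  moreover have "normal_form (contract j b r) = contract j b r" for r by (simp add: contract_def)
  moreover have "(\<Sum>(w, r)\<leftarrow>map snd (filter (\<lambda>p. fst p = s) (map (\<lambda>r. (contract j b r, weight 6 j b r, r)) rs)). of_nat w * a r) =
      (\<Sum>r\<leftarrow>rs. a r * of_nat (weight N j b r) * of_bool (contract j b r = s))" for rs
    by (induction rs) (auto simp: N mult.commute)
  ultimately show ?thesis
    using distinct_crossing_forms_6 by (simp add: eqn' sum_list_distinct_conv_sum_set)
qed

lemma all_rows_labels: "eqn \<in> set (all_rows rs ss) \<Longrightarrow> (w, r) \<in> set eqn \<Longrightarrow> r \<in> set rs"
  by (auto simp: all_rows_def contraction_rows_def group_rows_def)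

lemma length_all_rows: "length (all_rows rs ss) = 12 * length ss"
  by (simp add: all_rows_def contraction_rows_def group_rows_def upt_rec)

section \<open>Zeros of families of linear forms\<close>

definition pivot :: "int list \<Rightarrow> nat" where
  "pivot v = length (takeWhile (\<lambda>c. c = 0) v)"

text \<open>Fraction-free elimination of coordinate \<open>k\<close>: where \<open>v\<close>
  vanishes, the new form takes \<open>v ! k\<close> times the value of \<open>u\<close>.\<close>

definition eliminate :: "nat \<Rightarrow> int list \<Rightarrow> int list \<Rightarrow> int list" where
  "eliminate k v u = map2 (\<lambda>p q. v ! k * p - u ! k * q) u v"

definition all_zero :: "int list \<Rightarrow> bool" where
  "all_zero v = list_all (\<lambda>c. c = 0) v"

fun parallel :: "int \<Rightarrow> int \<Rightarrow> int list \<Rightarrow> int list \<Rightarrow> bool" where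
  "parallel a b (x # xs) (y # ys) = (a * y = b * x \<and> parallel a b xs ys)"
| "parallel a b _ _ = True"

text \<open>The condition on the pivot entry makes \<open>u\<close> a nonzero multiple of some
  \<open>d\<close> and excludes the zero form.\<close>

definition known_nonzero :: "int list list \<Rightarrow> int list \<Rightarrow> bool" where
  "known_nonzero ds u = list_ex (\<lambda>d. u ! pivot d \<noteq> 0 \<and> parallel (d ! pivot d) (u ! pivot d) d u) ds"

text \<open>Suppose that the form \<open>d\<close> does not vanish at \<open>x\<close>. Among the forms on one line through \<open>d\<close> in
  projective space, those vanishing at \<open>x\<close> are pairwise proportional. Projecting from \<open>d\<close>, the lines
  through \<open>d\<close> become points, and the number of zeros is at most the sum over these points of the
  largest multiplicity of a single form. In the pairs \<open>(L, k)\<close> below, \<open>L\<close> is the projection of a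
  form from \<open>d\<close> and \<open>k\<close> its eliminated coordinate.\<close>

definition class_max :: "(int \<times> int) list \<Rightarrow> nat" where
  "class_max g = fold max (map (\<lambda>p. length (filter (\<lambda>q. snd q * fst p = snd p * fst q) g)) g) 0"

definition on_line :: "nat \<Rightarrow> int list \<Rightarrow> int list \<times> int \<Rightarrow> bool" where
  "on_line q L p = parallel (L ! q) (fst p ! q) L (fst p)"

function line_bound :: "(int list \<times> int) list \<Rightarrow> nat" where
  "line_bound [] = 0"
| "line_bound ((L, k) # ps) =
     (if all_zero L then Suc (line_bound ps)
      else class_max (map (\<lambda>p. (fst p ! pivot L, snd p)) ((L, k) # filter (on_line (pivot L) L) ps)) +
        line_bound (filter (\<lambda>p. \<not> on_line (pivot L) L p) ps))"
  by pat_completeness auto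
termination
  by (relation "measure length") (auto simp: le_imp_less_Suc)

definition project :: "int list \<Rightarrow> int list \<Rightarrow> int list \<times> int" where
  "project d u = (eliminate (pivot d) d u, u ! pivot d)"

definition zero_bound :: "int list \<Rightarrow> int list list \<Rightarrow> int list list \<Rightarrow> nat" where
  "zero_bound d ds vs = line_bound (map (project d) (filter (\<lambda>u. \<not> known_nonzero ds u) vs))"

text \<open>\<open>Split i k l r\<close> distinguishes whether the \<open>i\<close>-th form vanishes, eliminating coordinate \<open>k\<close> with
  its help if it does. The list \<open>ds\<close> collects the forms known not to vanish; \<open>Bound i\<close> projects from
  its \<open>i\<close>-th member.\<close>

datatype certificate = Zero | Bound nat | Split nat nat certificate certificate

fun check :: "certificate \<Rightarrow> int list list \<Rightarrow> int list list \<Rightarrow> bool" where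
  "check Zero vs ds = list_all all_zero vs"
| "check (Bound i) vs ds = (i < length ds \<and> zero_bound (ds ! i) ds vs + 32 \<le> length vs)"
| "check (Split i k l r) vs ds = (i < length vs \<and> vs ! i ! k \<noteq> 0 \<and>
     check l (map (eliminate k (vs ! i)) vs) (map (eliminate k (vs ! i)) ds) \<and> check r vs (vs ! i # ds))"

section \<open>Soundness of the counting bound and of certificates\<close>

definition dot :: "int list \<Rightarrow> real list \<Rightarrow> real" where
  "dot v x = sum_list (map2 (\<lambda>c y. real_of_int c * y) v x)"

lemma dot_map2_add:
  "length u = length v \<Longrightarrow> length v = length x \<Longrightarrow>
    dot (map2 (\<lambda>p q. a * p + q) u v) x = real_of_int a * dot u x + dot v x"
  by (induction u v x rule: list_induct3) (simp_all add: dot_def algebra_simps)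

lemma dot_map2_diff:
  "length u = length v \<Longrightarrow> length v = length x \<Longrightarrow>
    dot (map2 (\<lambda>p q. a * p - b * q) u v) x = real_of_int a * dot u x - real_of_int b * dot v x"
  by (induction u v x rule: list_induct3) (simp_all add: dot_def algebra_simps)

lemma dot_map_mult: "dot (map (\<lambda>c. m * c) v) x = real_of_int m * dot v x"
  by (induction v x rule: list_induct2') (simp_all add: dot_def algebra_simps)

lemma dot_eliminate:
  "length u = length v \<Longrightarrow> length v = length x \<Longrightarrow> dot (eliminate k v u) x =
     real_of_int (v ! k) * dot u x - real_of_int (u ! k) * dot v x"
  by (simp add: eliminate_def dot_map2_diff)

lemma length_eliminate [simp]: "length (eliminate k v u) = min (length u) (length v)"
  by (simp add: eliminate_def)

lemma nth_pivot: "\<not> all_zero v \<Longrightarrow> v ! pivot v \<noteq> 0"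
  by (induction v) (auto simp: pivot_def all_zero_def)

lemma all_zero_dot: "all_zero v \<Longrightarrow> dot v x = 0"
  by (induction v x rule: list_induct2') (auto simp: all_zero_def dot_def)

lemma parallel_dot:
  "length u = length v \<Longrightarrow> length v = length x \<Longrightarrow> parallel a b v u \<Longrightarrow>
    real_of_int a * dot u x = real_of_int b * dot v x"
proof (induction u v x rule: list_induct3)
  case (Cons y ys z zs w ws)
  then have "real_of_int a * real_of_int y = real_of_int b * real_of_int z"
    by (metis of_int_mult parallel.simps(1))
  then show ?case using Cons by (simp add: dot_def algebra_simps)
qed (simp add: dot_def)

lemma known_nonzero_dot:
  assumes "known_nonzero ds u" "\<And>d. d \<in> set ds \<Longrightarrow> dot d x \<noteq> 0 \<and> length d = length x" "length u = length x"
  shows "dot u x \<noteq> 0"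
proof -
  obtain d where d: "d \<in> set ds" "u ! pivot d \<noteq> 0" "parallel (d ! pivot d) (u ! pivot d) d u"
    using assms(1) by (auto simp: known_nonzero_def list_ex_iff)
  have "real_of_int (d ! pivot d) * dot u x = real_of_int (u ! pivot d) * dot d x"
    using assms d by (intro parallel_dot) simp_all
  then show ?thesis using assms(2)[OF d(1)] d(2) by auto
qed

lemma length_filter_mono:
  "(\<And>x. x \<in> set xs \<Longrightarrow> P x \<Longrightarrow> Q x) \<Longrightarrow> length (filter P xs) \<le> length (filter Q xs)"
  by (induction xs) auto

lemma class_max_ge:
  assumes "(m0, k0) \<in> set g"
  shows "length (filter (\<lambda>(m, k). k * m0 = k0 * m) g) \<le> class_max g"
proof -
  let ?n = "\<lambda>p. length (filter (\<lambda>q. snd q * fst p = snd p * fst q) g)"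
  have "?n (m0, k0) \<le> Max (set (0 # map ?n g))"
  proof (rule Max_ge)
    have "?n (m0, k0) \<in> ?n ` set g" using assms by (rule imageI)
    then show "?n (m0, k0) \<in> set (0 # map ?n g)" by simp
  qed simp
  also have "\<dots> = class_max g"
    by (simp only: class_max_def Max.set_eq_fold)
  finally show ?thesis by (simp add: case_prod_unfold)
qed

lemma line_bound_ge:
  assumes "\<And>p. p \<in> set ps \<Longrightarrow> length (fst p) = length x" "D \<noteq> 0"
  shows "length (filter (\<lambda>p. dot (fst p) x = - real_of_int (snd p) * D) ps) \<le> line_bound ps"
  using assms(1)
proof (induction ps rule: line_bound.induct)
  case (2 L k ps)
  let ?P = "\<lambda>p. dot (fst p) x = - real_of_int (snd p) * D"
  show ?case
  proof (cases "all_zero L")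
    \<comment> \<open>A projection that is identically zero gives no information on
      \<open>x\<close>, so it is counted as a zero.\<close>
    case True
    then have "length (filter ?P ps) \<le> line_bound ps" by (intro "2.IH"(1)) (auto intro: "2.prems")
    then show ?thesis using True by simp
  next
    case False
    define q where "q = pivot L"
    \<comment> \<open>A pair on the line of \<open>L\<close> with entry m at \<open>q\<close> meets
      the condition only if its second component is m times \<open>t\<close>. As \<open>t\<close>
      depends on \<open>x\<close>, the bound takes the largest class over all ratios.\<close>
    define t where "t = - dot L x / (real_of_int (L ! q) * D)"
    let ?c = "\<lambda>p. (fst p ! q, snd p)"
    let ?Q = "\<lambda>(m, k). real_of_int k = real_of_int m * t"
    let ?g = "map ?c ((L, k) # filter (on_line q L) ps)"
    have Lq: "L ! q \<noteq> 0" using nth_pivot[OF False] by (simp add: q_def)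
    have in_class: "?Q (?c p)" if p: "p = (L, k) \<or> p \<in> set ps \<and> on_line q L p" "?P p" for p
    proof -
      have "real_of_int (L ! q) * dot (fst p) x = real_of_int (fst p ! q) * dot L x"
      proof (cases "p = (L, k)")
        case False
        then have "parallel (L ! q) (fst p ! q) L (fst p)" "length (fst p) = length L"
          using p(1) "2.prems" "2.prems"[of "(L, k)"] by (auto simp: on_line_def)
        then show ?thesis using "2.prems"[of "(L, k)"] by (intro parallel_dot) simp_all
      qed simp
      then show ?thesis using p(2) Lq \<open>D \<noteq> 0\<close> by (simp add: t_def field_simps)
    qed
    have split: "length (filter ?P qs) = length (filter ?P (filter (on_line q L) qs)) +
        length (filter ?P (filter (\<lambda>p. \<not> on_line q L p) qs))" for qs
      by (induction qs) auto
    have "length (filter ?P ((L, k) # ps)) =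
        length (filter ?P ((L, k) # filter (on_line q L) ps)) + length (filter ?P (filter (\<lambda>p. \<not> on_line q L p) ps))"
      using split[of ps] by simp
    moreover have "length (filter ?P ((L, k) # filter (on_line q L) ps)) \<le> class_max ?g"
    proof (cases "filter ?Q ?g = []")
      case True
      have "length (filter ?P ((L, k) # filter (on_line q L) ps)) \<le> length (filter (?Q \<circ> ?c) ((L, k) # filter (on_line q L) ps))"
        using in_class by (intro length_filter_mono) auto
      also have "\<dots> = length (filter ?Q ?g)" by (simp only: filter_map length_map)
      finally show ?thesis using True by simp
    next
      case False
      then obtain m0 k0 where mk: "(m0, k0) \<in> set ?g" "real_of_int k0 = real_of_int m0 * t"
        unfolding filter_empty_conv by (metis (mono_tags, lifting) case_prodE)
      have imp: "k * m0 = k0 * m" if "real_of_int k = real_of_int m * t" for m k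
      proof -
        have "real_of_int (k * m0) = real_of_int (k0 * m)" using that mk(2) by simp
        then show ?thesis by (simp only: of_int_eq_iff)
      qed
      have "length (filter ?P ((L, k) # filter (on_line q L) ps)) \<le> length (filter (?Q \<circ> ?c) ((L, k) # filter (on_line q L) ps))"
        using in_class by (intro length_filter_mono) auto
      also have "\<dots> = length (filter ?Q ?g)" by (simp only: filter_map length_map)
      also have "\<dots> \<le> length (filter (\<lambda>(m, k). k * m0 = k0 * m) ?g)"
        using imp by (intro length_filter_mono) auto
      also have "\<dots> \<le> class_max ?g" by (rule class_max_ge[OF mk(1)])
      finally show ?thesis .
    qed
    moreover have "length (filter ?P (filter (\<lambda>p. \<not> on_line q L p) ps)) \<le> line_bound (filter (\<lambda>p. \<not> on_line q L p) ps)"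
      unfolding q_def using False by (intro "2.IH"(2)) (auto intro: "2.prems")
    ultimately show ?thesis using False by (simp add: q_def)
  qed
qed simp

text \<open>If \<open>u\<close> vanishes at \<open>x\<close>, then its projection has the value
  \<open>- (u ! pivot d)\<close> times that of \<open>d\<close>, which is the condition counted by
  \<open>line_bound\<close>. Multiples of a form known not to vanish can be left out.\<close>

lemma zero_bound_ge:
  assumes len: "\<And>v. v \<in> set vs \<union> set ds \<Longrightarrow> length v = length x" and d: "d \<in> set ds"
    and ds: "\<And>d. d \<in> set ds \<Longrightarrow> dot d x \<noteq> 0"
  shows "length (filter (\<lambda>u. dot u x = 0) vs) \<le> zero_bound d ds vs"
proof -
  let ?P = "\<lambda>p. dot (fst p) x = - real_of_int (snd p) * dot d x"
  have zero: "?P (project d u)" if u: "u \<in> set vs" "dot u x = 0" for u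
    using dot_eliminate[of u d x "pivot d"] len[of u] len[of d] u d by (simp add: project_def)
  have unknown: "\<not> known_nonzero ds u" if u: "u \<in> set vs" "dot u x = 0" for u
    using known_nonzero_dot[of ds u x] ds len u by auto
  have "length (filter (\<lambda>u. dot u x = 0) vs) \<le>
      length (filter (?P \<circ> project d) (filter (\<lambda>u. \<not> known_nonzero ds u) vs))"
    unfolding filter_filter using zero unknown by (intro length_filter_mono) auto
  also have "\<dots> = length (filter ?P (map (project d) (filter (\<lambda>u. \<not> known_nonzero ds u) vs)))"
    by (simp add: filter_map)
  also have "\<dots> \<le> zero_bound d ds vs"
    unfolding zero_bound_def using len d ds
    by (intro line_bound_ge) (auto simp: project_def)
  finally show ?thesis .
qed

text \<open>If the split form \<open>v\<close> vanishes at \<open>x\<close>, elimination multiplies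
  all values by the nonzero number \<open>v ! k\<close> and preserves the count; otherwise
  \<open>v\<close> joins the forms known not to vanish. At a leaf \<open>Bound\<close> there are so
  few zeros that 32 nonzero values remain.\<close>

lemma check_sound:
  assumes "check c vs ds" "\<And>v. v \<in> set vs \<union> set ds \<Longrightarrow> length v = length x"
    and "\<And>d. d \<in> set ds \<Longrightarrow> dot d x \<noteq> 0"
  shows "(\<forall>v\<in>set vs. dot v x = 0) \<or> 32 \<le> length (filter (\<lambda>v. dot v x \<noteq> 0) vs)"
  using assms
proof (induction c vs ds rule: check.induct)
  case (1 vs ds)
  then show ?case by (auto simp: list_all_iff all_zero_dot)
next
  case (2 i vs ds)
  then have "length (filter (\<lambda>u. dot u x = 0) vs) \<le> zero_bound (ds ! i) ds vs"
    by (intro zero_bound_ge) auto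
  then show ?case using 2(1) sum_length_filter_compl[of "\<lambda>u. dot u x = 0" vs] by simp
next
  case (3 i k l r vs ds)
  define v where "v = vs ! i"
  from 3(3) have v: "v \<in> set vs" "v ! k \<noteq> 0" by (auto simp: v_def)
  show ?case
  proof (cases "dot v x = 0")
    case False
    then show ?thesis using 3 v by (intro "3.IH"(2)) (auto simp: v_def)
  next
    case True
    let ?e = "eliminate k v"
    have e: "length (?e u) = length x \<and> (dot (?e u) x = 0 \<longleftrightarrow> dot u x = 0)" if u: "u \<in> set vs \<union> set ds" for u
      using dot_eliminate[of u v x k] True "3.prems"(2) u v by simp
    have "(\<forall>v\<in>set (map ?e vs). dot v x = 0) \<or> 32 \<le> length (filter (\<lambda>v. dot v x \<noteq> 0) (map ?e vs))"
      unfolding v_def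
    proof (rule "3.IH"(1))
      show "check l (map (eliminate k (vs ! i)) vs) (map (eliminate k (vs ! i)) ds)"
        using "3.prems"(1) by simp
    qed (use e "3.prems"(3) in \<open>auto simp: v_def\<close>)
    moreover have "length (filter (\<lambda>v. dot v x \<noteq> 0) (map ?e vs)) = length (filter (\<lambda>v. dot v x \<noteq> 0) vs)"
    proof -
      have "filter (\<lambda>u. dot (?e u) x \<noteq> 0) vs = filter (\<lambda>v. dot v x \<noteq> 0) vs"
        using e by (intro filter_cong) auto
      then show ?thesis by (simp add: filter_map comp_def)
    qed
    ultimately show ?thesis using e by auto
  qed
qed

section \<open>Solutions of the equations\<close>

definition combination :: "(nat list \<times> int list) list \<Rightarrow> (nat \<times> nat list) list \<Rightarrow> int list" where
  "combination K eqn = foldr (\<lambda>(w, r) f. case map_of K r of None \<Rightarrow> f | Some g \<Rightarrow> map2 (\<lambda>p q. int w * p + q) g f)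
     eqn (replicate 6 0)"

text \<open>The integer division is tested by multiplying back. A row without exactly one unknown,
  or without an integral solution, leaves \<open>K\<close> as it is, so every order of the rows is
  sound.\<close>

definition solve_row :: "(nat list \<times> int list) list \<Rightarrow> (nat \<times> nat list) list \<Rightarrow> (nat list \<times> int list) list" where
  "solve_row K eqn = (case filter (\<lambda>(w, r). map_of K r = None) eqn of
     [(w, r)] \<Rightarrow>
       let f = combination K eqn; g = map (\<lambda>c. - (c div int w)) f
       in if w \<noteq> 0 \<and> map (\<lambda>c. - int w * c) g = f then (r, g) # K else K
   | _ \<Rightarrow> K)"

definition solves :: "(nat list \<Rightarrow> real) \<Rightarrow> real list \<Rightarrow> (nat list \<times> int list) list \<Rightarrow> bool" where
  "solves a x K \<longleftrightarrow> (\<forall>(r, f)\<in>set K. length f = length x \<and> a r = dot f x)"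

lemma solvesD: "solves a x K \<Longrightarrow> map_of K r = Some f \<Longrightarrow> length f = length x \<and> a r = dot f x"
  by (auto simp: solves_def dest: map_of_SomeD)

lemma combination_sound:
  assumes K: "solves a x K" and x: "length x = 6"
  shows "length (combination K eqn) = 6 \<and>
    dot (combination K eqn) x = (\<Sum>(w, r)\<leftarrow>filter (\<lambda>(w, r). map_of K r \<noteq> None) eqn. real w * a r)"
proof (induction eqn)
  case Nil
  then show ?case by (simp add: combination_def all_zero_dot all_zero_def list_all_iff)
next
  case (Cons p eqn)
  obtain w r where p: "p = (w, r)" by fastforce
  show ?case
  proof (cases "map_of K r")
    case None
    then show ?thesis using Cons p by (simp add: combination_def)
  next
    case (Some g)
    then have "length g = 6" "a r = dot g x" using solvesD[OF K] x by auto
    moreover have "combination K (p # eqn) = map2 (\<lambda>p q. int w * p + q) g (combination K eqn)"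
      using Some p by (simp add: combination_def)
    ultimately show ?thesis using Cons p Some x dot_map2_add[of g "combination K eqn" x "int w"] by simp
  qed
qed

lemma solve_row_sound:
  assumes K: "solves a x K" and x: "length x = 6" and eqn: "(\<Sum>(w, r)\<leftarrow>eqn. real w * a r) = 0"
  shows "solves a x (solve_row K eqn)"
proof -
  let ?u = "filter (\<lambda>(w, r). map_of K r = None) eqn"
  have split: "(\<Sum>(w, r)\<leftarrow>eqn. real w * a r) =
      (\<Sum>(w, r)\<leftarrow>filter (\<lambda>(w, r). map_of K r \<noteq> None) eqn. real w * a r) + (\<Sum>(w, r)\<leftarrow>?u. real w * a r)"
    by (induction eqn) auto
  show ?thesis
  proof (cases "\<exists>w r. ?u = [(w, r)]")
    case True
    then obtain w r where u: "?u = [(w, r)]" by blast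
    define f where "f = combination K eqn"
    define g where "g = map (\<lambda>c. - (c div int w)) f"
    have f: "length f = 6" "dot f x = - (real w * a r)"
      using combination_sound[OF K x, of eqn] split eqn u by (simp_all add: f_def)
    have step: "solve_row K eqn = (if w \<noteq> 0 \<and> map (\<lambda>c. - int w * c) g = f then (r, g) # K else K)"
      by (simp only: solve_row_def u Let_def f_def g_def list.case prod.case)
    show ?thesis
    proof (cases "w \<noteq> 0 \<and> map (\<lambda>c. - int w * c) g = f")
      case True
      then have "- real w * dot g x = - (real w * a r)"
        using dot_map_mult[of "- int w" g x] f(2) by simp
      then have "a r = dot g x" using True by simp
      then show ?thesis using K True f(1) x step by (simp add: solves_def g_def)
    next
      case False
      then show ?thesis using K step by auto
    qed
  next
    case False
    then have "solve_row K eqn = K"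
      unfolding solve_row_def by (auto split: list.splits)
    then show ?thesis using K by simp
  qed
qed

text \<open>Every other coefficient is determined by these six, and the sixth one by the first five
  (\<open>relation\<close>). The order in which the equations are used was found by a computer search, and so was
  the case distinction \<open>weight_certificate\<close>.\<close>

definition parameters :: "(nat list \<times> int list) list" where
  "parameters =
    [([0, 1, 2, 3, 0, 1], [1, 0, 0, 0, 0, 0]), ([0, 1, 2, 3, 0, 3], [0, 1, 0, 0, 0, 0]),
     ([0, 1, 2, 3, 1, 2], [0, 0, 1, 0, 0, 0]), ([0, 1, 2, 3, 1, 3], [0, 0, 0, 1, 0, 0]),
     ([0, 1, 2, 3, 2, 3], [0, 0, 0, 0, 1, 0]), ([0, 0, 0, 3, 0, 3], [0, 0, 0, 0, 0, 1])]"

definition solving_order :: "nat list" where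
  "solving_order =
    [19, 39, 59, 18, 33, 55, 23, 29, 45, 8, 117, 63, 73, 95, 107, 67, 77, 10, 9, 118, 35, 0, 42,
     52, 17, 38, 7, 115, 49, 6, 16, 57, 85, 28, 65, 75, 15, 37, 48, 58, 79, 69, 93, 97, 36, 56, 82,
     46, 60, 70, 99, 113, 25, 13, 119, 98, 12, 22, 26, 4, 78, 1, 20, 89, 90]"

definition relation :: "int list" where
  "relation = [4, -5, 1, -4, -4, 1]"

definition weight_certificate :: certificate where
  "weight_certificate =
     Split 4 1 (Split 7 2 (Split 5 0 (Split 24 3 (Split 9 4 Zero (Bound 0)) (Split 18 3 (Bound 0)
     (Bound 0))) (Bound 0)) (Split 5 3 (Bound 0) (Bound 0))) (Split 18 1 (Split 9 4 (Split 16 3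
     (Split 3 0 (Bound 0) (Split 1 2 (Bound 0) (Bound 0))) (Bound 0)) (Split 8 3 (Bound 0) (Split 16
     3 (Bound 1) (Bound 2)))) (Split 9 4 (Split 27 3 (Split 0 2 (Split 17 0 (Bound 0) (Split 37 0
     (Bound 0) (Bound 0))) (Bound 1)) (Split 17 3 (Bound 1) (Bound 2))) (Split 56 0 (Split 29 3
     (Bound 1) (Bound 2)) (Split 61 3 (Bound 0) (Split 39 3 (Split 3 1 (Bound 0) (Bound 0)) (Split
     49 3 (Bound 1) (Split 37 2 (Bound 0) (Bound 7))))))))"

text \<open>The 65 rows of \<open>solving_order\<close> and the six parameters account for all 71
  coefficients.\<close>

definition solve_rows :: "(nat \<times> nat list) list list \<Rightarrow> (nat list \<times> int list) list" where
  "solve_rows R = foldl solve_row parameters (map ((!) R) solving_order)"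

text \<open>Row 40 is absent from \<open>solving_order\<close>. With all its labels expressed in the
  parameters it becomes a multiple of \<open>relation\<close>, modulo which the sixth coordinate is
  eliminated from all forms.\<close>

definition check_solution :: "(nat list \<times> int list) list \<Rightarrow> (nat \<times> nat list) list list \<Rightarrow> nat list list \<Rightarrow> bool" where
  "check_solution K R rs \<longleftrightarrow> list_all (\<lambda>r. map_of K r \<noteq> None) rs \<and>
     combination K (R ! 40) = map (\<lambda>c. - 2 * c) relation \<and>
     check weight_certificate (map (\<lambda>r. eliminate 5 relation (the (map_of K r))) rs) []"

definition check_rows :: "(nat \<times> nat list) list list \<Rightarrow> nat list list \<Rightarrow> bool" where
  "check_rows R rs \<longleftrightarrow> check_solution (solve_rows R) R rs"

lemma check_rows_6: "check_rows (all_rows (crossing_forms 6) (crossing_forms 5)) (crossing_forms 6)"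
  by code_simp

lemma many_nonzero_coefficients:
  fixes a :: "nat list \<Rightarrow> real"
  assumes eqs: "\<And>eqn. eqn \<in> set (all_rows (crossing_forms 6) (crossing_forms 5)) \<Longrightarrow>
    (\<Sum>(w, r)\<leftarrow>eqn. real w * a r) = 0"
  shows "(\<forall>r\<in>set (crossing_forms 6). a r = 0) \<or> 32 \<le> length (filter (\<lambda>r. a r \<noteq> 0) (crossing_forms 6))"
proof -
  let ?R = "all_rows (crossing_forms 6) (crossing_forms 5)"
  \<comment> \<open>The values of the given solution at the parameters, at which all forms are
    evaluated.\<close>
  define x where "x = map (a \<circ> fst) parameters"
  define K where "K = solve_rows ?R"
  have x: "length x = 6" by (simp add: x_def parameters_def)
  have R: "?R ! i \<in> set ?R" if "i < 120" for i
    using that by (simp add: length_all_rows crossing_forms_5)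
  have "solves a x (foldl solve_row K0 es)" if "solves a x K0" "set es \<subseteq> set ?R" for K0 es
    using that by (induction es arbitrary: K0) (auto intro!: solve_row_sound[OF _ x] eqs)
  moreover have "solves a x parameters"
    by (simp add: solves_def x_def parameters_def dot_def)
  moreover have "list_all (\<lambda>i. i < 120) solving_order" by (simp add: solving_order_def)
  then have "set (map ((!) ?R) solving_order) \<subseteq> set ?R"
    using R by (auto simp: list_all_iff)
  ultimately have K: "solves a x K" unfolding K_def solve_rows_def by blast
  have check: "\<And>r. r \<in> set (crossing_forms 6) \<Longrightarrow> map_of K r \<noteq> None"
    "combination K (?R ! 40) = map (\<lambda>c. - 2 * c) relation"
    "check weight_certificate (map (\<lambda>r. eliminate 5 relation (the (map_of K r))) (crossing_forms 6)) []"
    using check_rows_6 unfolding check_rows_def check_solution_def K_def[symmetric] by (auto simp: list_all_iff)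
  have rel: "dot relation x = 0"
  proof -
    have "filter (\<lambda>(w, r). map_of K r \<noteq> None) (?R ! 40) = ?R ! 40"
      using all_rows_labels[OF R[of 40]] check(1) by (intro filter_True) auto
    then have "dot (combination K (?R ! 40)) x = 0"
      using combination_sound[OF K x, of "?R ! 40"] eqs[OF R[of 40]] by simp
    then show ?thesis unfolding check(2) dot_map_mult by simp
  qed
  let ?e = "\<lambda>r. eliminate 5 relation (the (map_of K r))"
  \<comment> \<open>The last entry of \<open>relation\<close> is 1, so this elimination does not
    change the value of a form at \<open>x\<close>.\<close>
  have e: "length (?e r) = 6 \<and> dot (?e r) x = a r" if r: "r \<in> set (crossing_forms 6)" for r
  proof -
    obtain f where "map_of K r = Some f" using check(1)[OF r] by auto
    then show ?thesis
      using solvesD[OF K] x dot_eliminate[of f relation x 5] rel by (auto simp: relation_def)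
  qed
  have "(\<forall>v\<in>set (map ?e (crossing_forms 6)). dot v x = 0) \<or>
      32 \<le> length (filter (\<lambda>v. dot v x \<noteq> 0) (map ?e (crossing_forms 6)))"
    using e x by (intro check_sound[OF check(3)]) auto
  moreover have "filter (\<lambda>r. dot (?e r) x \<noteq> 0) (crossing_forms 6) = filter (\<lambda>r. a r \<noteq> 0) (crossing_forms 6)"
    using e by (intro filter_cong) auto
  ultimately show ?thesis using e by (auto simp: filter_map comp_def)
qed

section \<open>Maximality\<close>

theorem theoremC:
  shows "maximal_at_easiness_moment_level 6 31 6"
  unfolding maximal_at_easiness_moment_level_def
proof (intro allI impI)
  fix p :: "nat \<Rightarrow> nat set set" and \<alpha> :: "nat \<Rightarrow> complex" and v :: "complex mat"
  let ?I = "{1..31::nat}" and ?S = "set (crossing_forms 6)"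
  assume p: "\<forall>i\<in>?I. p i \<in> crossing_partitions 6"
    and v: "v = finsum (mat_space (6 ^ 6) 1) (\<lambda>i. \<alpha> i \<cdot>\<^sub>m xi 6 6 (p i)) ?I"
    and v0: "v \<noteq> 0\<^sub>m (6 ^ 6) 1"
  have "\<forall>i\<in>?I. \<exists>ls. length ls = 6 \<and> crosses ls \<and> xi 6 6 (p i) = pmat 6 [] ls"
    using p crossing_partition_labels[of _ 6 6] by metis
  then obtain ls where ls: "\<And>i. i \<in> ?I \<Longrightarrow> length (ls i) = 6 \<and> crosses (ls i) \<and> xi 6 6 (p i) = pmat 6 [] (ls i)"
    by metis
  define \<rho> where "\<rho> i = normal_form (ls i)" for i
  \<comment> \<open>The \<open>p i\<close> may coincide, so the coefficients of equal partitions are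
    added up.\<close>
  define a where "a r = (\<Sum>i\<in>?I. \<alpha> i * of_bool (\<rho> i = r))" for r
  have \<rho>: "\<rho> i \<in> ?S" if "i \<in> ?I" for i
    unfolding \<rho>_def using ls[OF that] normal_form_crossing[of "ls i" 6] by simp
  have xi: "xi 6 6 (p i) = tmat 6 0 6 (\<lambda>xs _. of_bool (fits (\<rho> i) xs))" if "i \<in> ?I" for i
    using ls[OF that] by (simp add: pmat_def \<rho>_def) (rule tmat_cong, simp)
  have "v = mat (6 ^ 6) 1 (\<lambda>ij. \<Sum>i\<in>?I. (\<alpha> i \<cdot>\<^sub>m xi 6 6 (p i)) $$ ij)"
    unfolding v by (rule finsum_mat_space) (simp_all add: xi tmat_def)
  also have "\<dots> = tmat 6 0 6 (\<lambda>xs _. \<Sum>i\<in>?I. \<alpha> i * of_bool (fits (\<rho> i) xs))"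
    by (rule eq_matI) (simp_all add: xi tmat_def)
  also have "\<dots> = tmat 6 0 6 (\<lambda>xs _. \<Sum>r\<in>?S. a r * of_bool (fits r xs))"
  proof (rule tmat_cong)
    fix xs :: "nat list"
    have *: "\<alpha> i * of_bool (fits (\<rho> i) xs) = (\<Sum>r\<in>?S. \<alpha> i * of_bool (\<rho> i = r) * of_bool (fits r xs))" if "i \<in> ?I" for i
      using \<rho>[OF that] by (subst sum_eq_single[of _ "\<rho> i"]) auto
    have "(\<Sum>i\<in>?I. \<alpha> i * of_bool (fits (\<rho> i) xs)) =
        (\<Sum>i\<in>?I. \<Sum>r\<in>?S. \<alpha> i * of_bool (\<rho> i = r) * of_bool (fits r xs))"
      by (rule sum.cong[OF refl *])
    also have "\<dots> = (\<Sum>r\<in>?S. a r * of_bool (fits r xs))"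
      unfolding a_def sum_distrib_right by (rule sum.swap)
    finally show "(\<Sum>i\<in>?I. \<alpha> i * of_bool (fits (\<rho> i) xs)) = (\<Sum>r\<in>?S. a r * of_bool (fits r xs))" .
  qed
  finally have v_eq: "v = tmat 6 0 6 (\<lambda>xs _. \<Sum>r\<in>?S. a r * of_bool (fits r xs))" .
  have carrier: "v \<in> carrier_mat (6 ^ 6) 1" using tmat_carrier[of 6 0 6] by (simp add: v_eq)
  interpret C: intermediate_dual 6 "NC_generated 6 6 v"
    using tannaka_krein_dual_NC_generated[OF carrier] by unfold_locales
  have "v \<in> NC_generated 6 6 v 0 6" by (rule tannaka_krein_dual_NC_generated(3)[OF carrier])
  then have mem: "C.tensor_mem 6 (\<lambda>xs. \<Sum>r\<in>?S. a r * of_bool (fits r xs))"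
    unfolding C.tensor_mem_def v_eq[symmetric] .
  have "pmat 6 [] [0, 1, 0, 1] \<in> NC_generated 6 6 v 0 4"
  proof (rule ccontr)
    assume "pmat 6 [] [0, 1, 0, 1] \<notin> NC_generated 6 6 v 0 4"
    note eqs = C.contraction_equation[OF refl this mem]
    have re: "Re (\<Sum>(w, r)\<leftarrow>eqn. of_nat w * a r) = (\<Sum>(w, r)\<leftarrow>eqn. real w * Re (a r))"
      and im: "Im (\<Sum>(w, r)\<leftarrow>eqn. of_nat w * a r) = (\<Sum>(w, r)\<leftarrow>eqn. real w * Im (a r))" for eqn
      by (induction eqn) auto
    \<comment> \<open>Only the label lists of the 31 given partitions can carry a nonzero
      coefficient; \<open>f\<close> stands for the real or the imaginary part.\<close>
    have few: "length (filter (\<lambda>r. f (a r) \<noteq> 0) (crossing_forms 6)) \<le> 31" if "f 0 = 0" for f :: "complex \<Rightarrow> real"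
    proof -
      have "a r = 0" if "r \<notin> \<rho> ` ?I" for r
        unfolding a_def using that by (intro sum.neutral) auto
      then have "set (filter (\<lambda>r. f (a r) \<noteq> 0) (crossing_forms 6)) \<subseteq> \<rho> ` ?I"
        using that by (metis (mono_tags, lifting) filter_is_subset mem_Collect_eq set_filter subsetI)
      then have "card (set (filter (\<lambda>r. f (a r) \<noteq> 0) (crossing_forms 6))) \<le> card (\<rho> ` ?I)"
        by (rule card_mono[rotated]) simp
      also have "\<dots> \<le> 31" using card_image_le[of ?I \<rho>] by simp
      finally show ?thesis
        by (simp add: distinct_card distinct_crossing_forms_6 del: set_filter)
    qed
    have "\<forall>r\<in>?S. Re (a r) = 0"
      using many_nonzero_coefficients[of "\<lambda>r. Re (a r)"] few[of Re] eqs by (simp flip: re)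
    moreover have "\<forall>r\<in>?S. Im (a r) = 0"
      using many_nonzero_coefficients[of "\<lambda>r. Im (a r)"] few[of Im] eqs by (simp flip: im)
    ultimately have "\<forall>r\<in>?S. a r = 0" by (simp add: complex_eq_iff)
    then show False using v0 tmat_zero[of 6 6 0] by (simp add: v_eq)
  qed
  then have "P_dual 6 \<le> NC_generated 6 6 v" by (rule C.P_dual_le)
  moreover have "NC_generated 6 6 v \<le> P_dual 6"
  proof (rule NC_generated_le[OF tannaka_krein_dual_P_dual NC_dual_le_P_dual])
    have "tmat 6 0 6 (\<lambda>xs _. of_bool (fits r xs)) \<in> P_dual 6 0 6" if "r \<in> ?S" for r
    proof -
      have "pmat 6 [] r = tmat 6 0 6 (\<lambda>xs _. of_bool (fits r xs))"
        using length_crossing_forms[OF that] by (simp add: pmat_def) (rule tmat_cong, simp)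
      then show ?thesis using P_dual_span(2)[of "[]" 0 r 6 6] length_crossing_forms[OF that] by simp
    qed
    then show "v \<in> P_dual 6 0 6"
      unfolding v_eq by (intro subspace_tmat_sum P_dual_span(1)) auto
  qed
  ultimately show "NC_generated 6 6 v = P_dual 6 \<or> NC_generated 6 6 v = NC_dual 6"
    by (simp add: order_antisym)
qed

end
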